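(* Let $G$ be an amenable, just infinite group. Then the following are equivalent: (1) $G$ is hereditarily just infinite; (2) $\mathcal{J}_{sn}(G)^{\Box 2}=\{0\}$; (3) $\mathcal{A}_{sn}(G)^{\Box 2}=\{0\}$.
   Context: All groups are discrete. For a group $G$, $\ell^1(G)$ is the Banach algebra of absolutely summable functions $G\to\mathbb{C}$ under convolution; $\delta_t$ is the point mass at $t$; $\ell^1(G)^*=\ell^\infty(G)$, and $1$ is the constant function. The bidual $\ell^1(G)^{**}$ carries the first Arens product $\Box$: for a Banach algebra $A$, $\langle \Psi\Box\Phi,\lambda\rangle=\langle\Psi,\Phi\cdot\lambda\rangle$, $\langle a,\Phi\cdot\lambda\rangle=\langle\Phi,\lambda\cdot a\rangle$, $\langle b,\lambda\cdot a\rangle=\langle ab,\lambda\rangle$ ($\Phi,\Psi\in A^{**}$, $\lambda\in A^*$, $a,b\in A$). For $H\le G$, $\ell^1(H)^{**}$ is identified with its image in $\ell^1(G)^{**}$ under the second adjoint of the inclusion $\ell^1(H)\hookrightarrow\ell^1(G)$. An invariant difference on a group $H$ is an element $\Gamma\in\ell^1(H)^{**}$ with $\delta_s\Box\Gamma=\Gamma$ for all $s\in H$ and $\langle\Gamma,1\rangle=0$. $\mathcal{D}(H)$ is the set of invariant differences on $H$. A subgroup $H\le G$ is subnormal if there is a finite chain $H=H_n\lhd H_{n-1}\lhd\cdots\lhd H_1\lhd G$. Define $$\mathcal{A}_{sn}(G)=\operatorname{span}\{\Gamma_1\Box\cdots\Box\Gamma_n : n\in\mathbb{N},\ \Gamma_i\in\mathcal{D}(H_i)\text{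 for some subnormal subgroups } H_i\text{ of }G\},$$ $$\mathcal{J}_{sn}(G)=\operatorname{span}\{\Phi\Box\Gamma:\Phi\in\ell^1(G)^{**},\ \Gamma\in\mathcal{D}(H)\text{ for some subnormal subgroup } H\text{ of } G\}.$$ For a subspace $I$ of $\ell^1(G)^{**}$, $I^{\Box 2}=\{0\}$ means $\Phi\Box\Psi=0$ for all $\Phi,\Psi\in I$. An infinite group is just infinite if every non-trivial normal subgroup has finite index. It is hereditarily just infinite if every non-trivial normal subgroup of it is just infinite. *)

theory Defs
  imports
    "HOL-Analysis.Analysis"
    "HOL-Algebra.Algebra"
    "HOL-Library.Function_Algebras"
begin

section \<open>Duals and the first Arens product\<close>

text \<open>
  A complex normed space is given by a set \<open>V\<close> of complex-valued functions, closed under the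
  pointwise operations, together with a norm \<open>n\<close>. The dual is again a space of this kind, so
  that the bidual is obtained by iterating. Functionals are normalised to vanish outside their
  domain; hence equality of functionals in HOL is equality on the domain.
\<close>

definition fscale :: "complex \<Rightarrow> ('i \<Rightarrow> complex) \<Rightarrow> 'i \<Rightarrow> complex" where
  "fscale c f = (\<lambda>x. c * f x)"

global_interpretation cfun: vector_space fscale
  by unfold_locales (auto simp: fscale_def fun_eq_iff algebra_simps)

definition dual ::
  "('i \<Rightarrow> complex) set \<Rightarrow> (('i \<Rightarrow> complex) \<Rightarrow> real) \<Rightarrow> (('i \<Rightarrow> complex) \<Rightarrow> complex) set" where
  "dual V n = {\<phi>. (\<forall>f\<in>V. \<forall>g\<in>V. \<phi> (f + g) = \<phi> f + \<phi> g) \<and>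
                   (\<forall>c. \<forall>f\<in>V. \<phi> (fscale c f) = c * \<phi> f) \<and>
                   (\<exists>C. \<forall>f\<in>V. norm (\<phi> f) \<le> C * n f) \<and>
                   (\<forall>f. f \<notin> V \<longrightarrow> \<phi> f = 0)}"

definition dual_norm ::
  "('i \<Rightarrow> complex) set \<Rightarrow> (('i \<Rightarrow> complex) \<Rightarrow> real) \<Rightarrow> (('i \<Rightarrow> complex) \<Rightarrow> complex) \<Rightarrow> real" where
  "dual_norm V n \<phi> = Sup {norm (\<phi> f) | f. f \<in> V \<and> n f \<le> 1}"

definition bidual ::
  "('i \<Rightarrow> complex) set \<Rightarrow> (('i \<Rightarrow> complex) \<Rightarrow> real)
    \<Rightarrow> ((('i \<Rightarrow> complex) \<Rightarrow> complex) \<Rightarrow> complex) set" where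
  "bidual V n = dual (dual V n) (dual_norm V n)"

definition bidual_norm ::
  "('i \<Rightarrow> complex) set \<Rightarrow> (('i \<Rightarrow> complex) \<Rightarrow> real)
    \<Rightarrow> ((('i \<Rightarrow> complex) \<Rightarrow> complex) \<Rightarrow> complex) \<Rightarrow> real" where
  "bidual_norm V n = dual_norm (dual V n) (dual_norm V n)"

definition canonical_embedding ::
  "('i \<Rightarrow> complex) set \<Rightarrow> (('i \<Rightarrow> complex) \<Rightarrow> real)
    \<Rightarrow> ('i \<Rightarrow> complex) \<Rightarrow> (('i \<Rightarrow> complex) \<Rightarrow> complex) \<Rightarrow> complex" where
  "canonical_embedding V n a = (\<lambda>\<phi>. if \<phi> \<in> dual V n then \<phi> a else 0)"

text \<open>The adjoint of a map \<open>T\<close> with domain \<open>V\<close>.\<close>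

definition adjoint_map :: "'v set \<Rightarrow> ('v \<Rightarrow> 'w) \<Rightarrow> ('w \<Rightarrow> complex) \<Rightarrow> 'v \<Rightarrow> complex" where
  "adjoint_map V T \<phi> = (\<lambda>f. if f \<in> V then \<phi> (T f) else 0)"

text \<open>
  In the next three definitions \<open>m\<close> is the multiplication of the Banach algebra \<open>A\<close>;
  they are \<open>\<langle>b, \<phi> \<cdot> a\<rangle> = \<langle>ab, \<phi>\<rangle>\<close>, \<open>\<langle>a, \<Phi> \<cdot> \<phi>\<rangle> = \<langle>\<Phi>, \<phi> \<cdot> a\<rangle>\<close> and
  \<open>\<langle>\<Psi> \<box> \<Phi>, \<phi>\<rangle> = \<langle>\<Psi>, \<Phi> \<cdot> \<phi>\<rangle>\<close>.
\<close>

definition dual_act ::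
  "('i \<Rightarrow> complex) set \<Rightarrow> (('i \<Rightarrow> complex) \<Rightarrow> ('i \<Rightarrow> complex) \<Rightarrow> 'i \<Rightarrow> complex)
    \<Rightarrow> (('i \<Rightarrow> complex) \<Rightarrow> complex) \<Rightarrow> ('i \<Rightarrow> complex) \<Rightarrow> ('i \<Rightarrow> complex) \<Rightarrow> complex" where
  "dual_act A m \<phi> a = (\<lambda>b. if b \<in> A then \<phi> (m a b) else 0)"

definition bidual_act ::
  "('i \<Rightarrow> complex) set \<Rightarrow> (('i \<Rightarrow> complex) \<Rightarrow> ('i \<Rightarrow> complex) \<Rightarrow> 'i \<Rightarrow> complex)
    \<Rightarrow> ((('i \<Rightarrow> complex) \<Rightarrow> complex) \<Rightarrow> complex) \<Rightarrow> (('i \<Rightarrow> complex) \<Rightarrow> complex)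
    \<Rightarrow> ('i \<Rightarrow> complex) \<Rightarrow> complex" where
  "bidual_act A m \<Phi> \<phi> = (\<lambda>a. if a \<in> A then \<Phi> (dual_act A m \<phi> a) else 0)"

definition arens_product ::
  "('i \<Rightarrow> complex) set \<Rightarrow> (('i \<Rightarrow> complex) \<Rightarrow> real)
    \<Rightarrow> (('i \<Rightarrow> complex) \<Rightarrow> ('i \<Rightarrow> complex) \<Rightarrow> 'i \<Rightarrow> complex)
    \<Rightarrow> ((('i \<Rightarrow> complex) \<Rightarrow> complex) \<Rightarrow> complex) \<Rightarrow> ((('i \<Rightarrow> complex) \<Rightarrow> complex) \<Rightarrow> complex)
    \<Rightarrow> (('i \<Rightarrow> complex) \<Rightarrow> complex) \<Rightarrow> complex" where
  "arens_product A n m \<Psi> \<Phi> = (\<lambda>\<phi>. if \<phi> \<in> dual A n then \<Psi> (bidual_act A m \<Phi> \<phi>) else 0)"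


section \<open>The group algebra\<close>

text \<open>
  Elements of \<open>\<ell>\<^sup>1(G)\<close> are functions on the whole type that vanish outside the carrier, so for a
  subgroup \<open>H\<close> the inclusion of \<open>\<ell>\<^sup>1(H)\<close> into \<open>\<ell>\<^sup>1(G)\<close> (extension by zero) is the identity map.
\<close>

definition ell1 :: "('a, 'b) monoid_scheme \<Rightarrow> ('a \<Rightarrow> complex) set" where
  "ell1 G = {f. (\<lambda>t. norm (f t)) summable_on carrier G \<and> (\<forall>t. t \<notin> carrier G \<longrightarrow> f t = 0)}"

definition ell1_norm :: "('a, 'b) monoid_scheme \<Rightarrow> ('a \<Rightarrow> complex) \<Rightarrow> real" where
  "ell1_norm G f = (\<Sum>\<^sub>\<infinity>t\<in>carrier G. norm (f t))"

definition convolution ::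
  "('a, 'b) monoid_scheme \<Rightarrow> ('a \<Rightarrow> complex) \<Rightarrow> ('a \<Rightarrow> complex) \<Rightarrow> 'a \<Rightarrow> complex" where
  "convolution G f g =
    (\<lambda>t. if t \<in> carrier G then \<Sum>\<^sub>\<infinity>s\<in>carrier G. f s * g (inv\<^bsub>G\<^esub> s \<otimes>\<^bsub>G\<^esub> t) else 0)"

definition point_mass :: "'a \<Rightarrow> 'a \<Rightarrow> complex" where
  "point_mass t = (\<lambda>s. if s = t then 1 else 0)"

text \<open>
  The identification of \<open>\<ell>\<^sup>\<infinity>(G)\<close> with the dual of \<open>\<ell>\<^sup>1(G)\<close>: the functional induced by a
  bounded function \<open>h\<close>.
\<close>

definition linf_functional ::
  "('a, 'b) monoid_scheme \<Rightarrow> ('a \<Rightarrow> complex) \<Rightarrow> ('a \<Rightarrow> complex) \<Rightarrow> complex" where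
  "linf_functional G h = (\<lambda>f. if f \<in> ell1 G then \<Sum>\<^sub>\<infinity>t\<in>carrier G. f t * h t else 0)"

abbreviation one_functional :: "('a, 'b) monoid_scheme \<Rightarrow> ('a \<Rightarrow> complex) \<Rightarrow> complex" where
  "one_functional G \<equiv> linf_functional G (\<lambda>_. 1)"

type_synonym 'a bidual_elt = "(('a \<Rightarrow> complex) \<Rightarrow> complex) \<Rightarrow> complex"

definition ell1_bidual :: "('a, 'b) monoid_scheme \<Rightarrow> 'a bidual_elt set" where
  "ell1_bidual G = bidual (ell1 G) (ell1_norm G)"

definition arens ::
  "('a, 'b) monoid_scheme \<Rightarrow> 'a bidual_elt \<Rightarrow> 'a bidual_elt \<Rightarrow> 'a bidual_elt" where
  "arens G = arens_product (ell1 G) (ell1_norm G) (convolution G)"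

definition delta :: "('a, 'b) monoid_scheme \<Rightarrow> 'a \<Rightarrow> 'a bidual_elt" where
  "delta G s = canonical_embedding (ell1 G) (ell1_norm G) (point_mass s)"

text \<open>The second adjoint of the inclusion of \<open>\<ell>\<^sup>1(H)\<close> into \<open>\<ell>\<^sup>1(G)\<close>.\<close>

definition bidual_inclusion :: "('a, 'b) monoid_scheme \<Rightarrow> 'a set \<Rightarrow> 'a bidual_elt \<Rightarrow> 'a bidual_elt" where
  "bidual_inclusion G H =
    adjoint_map (dual (ell1 G) (ell1_norm G)) (adjoint_map (ell1 (G\<lparr>carrier := H\<rparr>)) id)"

text \<open>Amenability: existence of a left-invariant mean on \<open>\<ell>\<^sup>\<infinity>(G)\<close>.\<close>

definition amenable :: "('a, 'b) monoid_scheme \<Rightarrow> bool" where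
  "amenable G \<longleftrightarrow> (\<exists>M\<in>ell1_bidual G.
      bidual_norm (ell1 G) (ell1_norm G) M = 1 \<and> M (one_functional G) = 1 \<and>
      (\<forall>s\<in>carrier G. arens G (delta G s) M = M))"


section \<open>Invariant differences\<close>

definition invariant_differences :: "('a, 'b) monoid_scheme \<Rightarrow> 'a bidual_elt set" where
  "invariant_differences H = {\<Gamma>\<in>ell1_bidual H.
      (\<forall>s\<in>carrier H. arens H (delta H s) \<Gamma> = \<Gamma>) \<and> \<Gamma> (one_functional H) = 0}"

definition subnormal :: "'a set \<Rightarrow> ('a, 'b) monoid_scheme \<Rightarrow> bool" where
  "subnormal H G \<longleftrightarrow> (\<exists>n. \<exists>K :: nat \<Rightarrow> 'a set. K 0 = carrier G \<and> K n = H \<and>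
      (\<forall>i<n. K (Suc i) \<lhd> G\<lparr>carrier := K i\<rparr>))"

text \<open>The union, inside \<open>\<ell>\<^sup>1(G)\<^sup>*\<^sup>*\<close>, of the sets \<open>D(H)\<close> over the subnormal subgroups \<open>H\<close> of \<open>G\<close>.\<close>

definition D_sn :: "('a, 'b) monoid_scheme \<Rightarrow> 'a bidual_elt set" where
  "D_sn G = (\<Union>H\<in>{H. subnormal H G}.
      bidual_inclusion G H ` invariant_differences (G\<lparr>carrier := H\<rparr>))"

text \<open>
  Only products with at least one factor occur: an empty product would be the identity
  \<open>\<delta>\<^sub>e\<close> of the bidual.
\<close>

definition A_sn :: "('a, 'b) monoid_scheme \<Rightarrow> 'a bidual_elt set" where
  "A_sn G = cfun.span {foldl (arens G) \<Gamma> \<Gamma>s | \<Gamma> \<Gamma>s. \<Gamma> \<in> D_sn G \<and> set \<Gamma>s \<subseteq> D_sn G}"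

definition J_sn :: "('a, 'b) monoid_scheme \<Rightarrow> 'a bidual_elt set" where
  "J_sn G = cfun.span {arens G \<Phi> \<Gamma> | \<Phi> \<Gamma>. \<Phi> \<in> ell1_bidual G \<and> \<Gamma> \<in> D_sn G}"

definition square_zero :: "('a, 'b) monoid_scheme \<Rightarrow> 'a bidual_elt set \<Rightarrow> bool" where
  "square_zero G I \<longleftrightarrow> (\<forall>\<Phi>\<in>I. \<forall>\<Psi>\<in>I. arens G \<Phi> \<Psi> = 0)"


section \<open>Just infinite groups\<close>

definition just_infinite :: "('a, 'b) monoid_scheme \<Rightarrow> bool" where
  "just_infinite G \<longleftrightarrow> infinite (carrier G) \<and>
      (\<forall>N. N \<lhd> G \<and> N \<noteq> {\<one>\<^bsub>G\<^esub>} \<longrightarrow> finite (rcosets\<^bsub>G\<^esub> N))"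

definition hereditarily_just_infinite :: "('a, 'b) monoid_scheme \<Rightarrow> bool" where
  "hereditarily_just_infinite G \<longleftrightarrow> infinite (carrier G) \<and>
      (\<forall>N. N \<lhd> G \<and> N \<noteq> {\<one>\<^bsub>G\<^esub>} \<longrightarrow> just_infinite (G\<lparr>carrier := N\<rparr>))"

end

theory Submission
  imports Defs
begin

text \<open>
  Writing elements of \<open>\<ell>\<^sup>1(G)\<^sup>*\<^sup>*\<close> as functionals on bounded functions, \<open>\<langle>\<Psi> \<box> \<Phi>, h\<rangle>\<close> is
  \<open>\<Psi>\<close> applied to \<open>t \<mapsto> \<langle>\<Phi>, h(t \<cdot>)\<rangle>\<close>.

  If \<open>G\<close> is hereditarily just infinite, every subnormal subgroup \<open>K\<close> is finite, so that \<open>D(K) = 0\<close>,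
  or contains a normal subgroup \<open>N\<close> of finite index in \<open>G\<close>. In the second case, for \<open>\<Delta> \<in> D(K)\<close>,
  the function \<open>t \<mapsto> \<langle>\<Psi> \<box> \<Delta>, h(t \<cdot>)\<rangle>\<close> is \<open>N\<close>-invariant, so it takes finitely many values, and an
  invariant difference on any subgroup averages it to a multiple of \<open>\<langle>\<Gamma>, 1\<rangle> = 0\<close>.

  If \<open>G\<close> is not hereditarily just infinite, some normal subgroup \<open>N\<close> has a nontrivial normal subgroup
  of infinite index. Intersecting a maximal family of its conjugates with nontrivial intersection gives
  an infinite subnormal \<open>B\<close> meeting one of its conjugates \<open>C\<close> trivially, and then
  \<open>\<langle>\<Gamma> \<box> \<Delta>, f \<otimes> k\<rangle> = \<langle>\<Gamma>, f\<rangle> \<langle>\<Delta>, k\<rangle>\<close> for \<open>\<Gamma> \<in> D(B)\<close>, \<open>\<Delta> \<in> D(C)\<close>. It remains to produce a nonzero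
  invariant difference on an infinite amenable group: choose sequences \<open>g\<close>, \<open>g'\<close> and a bounded \<open>f\<close>
  with \<open>f(t g\<^sub>n) \<rightarrow> 1\<close> and \<open>f(t g'\<^sub>n) \<rightarrow> 0\<close> for all \<open>t\<close>, and compare the invariant means
  \<open>h \<mapsto> M\<^sub>t M\<^sub>u h(t g\<^bsub>\<nu>(u)\<^esub>)\<close> and \<open>h \<mapsto> M\<^sub>t M\<^sub>u h(t g'\<^bsub>\<nu>(u)\<^esub>)\<close>. Here \<open>\<nu>\<close> numbers the translates, by a
  countably infinite subgroup, of a transversal of that subgroup. They are disjoint and infinitely many,
  hence \<open>M\<close>-null, so \<open>M\<^sub>u\<close> takes a limit along \<open>\<nu>(u) \<rightarrow> \<infinity>\<close>.
\<close>

section \<open>Functionals on the group algebra\<close>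

lemma ell1_abs: "f \<in> ell1 G \<Longrightarrow> (\<lambda>t. norm (f t)) summable_on carrier G"
  by (simp add: ell1_def)

lemma ell1_zero: "0 \<in> ell1 G"
  by (simp add: ell1_def)

lemma ell1_add:
  assumes "f \<in> ell1 G" "g \<in> ell1 G"
  shows "f + g \<in> ell1 G"
proof -
  have "(\<lambda>t. norm (f t) + norm (g t)) summable_on carrier G"
    using assms by (intro summable_on_add ell1_abs)
  then have "(\<lambda>t. norm (f t + g t)) summable_on carrier G"
    by (rule Infinite_Sum.abs_summable_on_comparison_test') (simp add: norm_triangle_ineq)
  then show ?thesis using assms by (simp add: ell1_def)
qed

lemma ell1_scale: "f \<in> ell1 G \<Longrightarrow> fscale c f \<in> ell1 G"
  by (simp add: ell1_def fscale_def norm_mult summable_on_cmult_right)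

lemma ell1_norm_nonneg: "0 \<le> ell1_norm G f"
  by (simp add: ell1_norm_def infsum_nonneg)

lemma point_mass_ell1:
  assumes "t \<in> carrier G"
  shows "point_mass t \<in> ell1 G"
proof -
  have "(\<lambda>s. norm (point_mass t s)) summable_on carrier G"
    by (rule finite_nonzero_values_imp_summable_on) (simp add: point_mass_def)
  then show ?thesis using assms by (auto simp: ell1_def point_mass_def)
qed

lemma ell1_norm_point_mass:
  assumes "t \<in> carrier G"
  shows "ell1_norm G (point_mass t) = 1"
proof -
  have "ell1_norm G (point_mass t) = (\<Sum>\<^sub>\<infinity>s\<in>{t}. norm (point_mass t s))"
    unfolding ell1_norm_def by (rule infsum_cong_neutral) (use assms in \<open>auto simp: point_mass_def\<close>)
  then show ?thesis by (simp add: point_mass_def)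
qed

lemma summable_ell1_mult:
  fixes h :: "'a \<Rightarrow> complex"
  assumes f: "f \<in> ell1 G" and h: "bounded (h ` carrier G)"
  shows "(\<lambda>t. norm (f t * h t)) summable_on carrier G" "(\<lambda>t. f t * h t) summable_on carrier G"
proof -
  obtain C where C: "\<And>t. t \<in> carrier G \<Longrightarrow> norm (h t) \<le> C"
    using h by (auto simp: bounded_iff)
  have "(\<lambda>t. norm (f t) * C) summable_on carrier G"
    by (intro summable_on_cmult_left ell1_abs f)
  then show *: "(\<lambda>t. norm (f t * h t)) summable_on carrier G"
    by (rule Infinite_Sum.abs_summable_on_comparison_test') (simp add: norm_mult mult_left_mono C)
  show "(\<lambda>t. f t * h t) summable_on carrier G"
    using abs_summable_summable[OF *] .
qed

section \<open>The pairing of summable with bounded functions\<close>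

lemma linf_cong:
  "(\<And>t. t \<in> carrier G \<Longrightarrow> h t = k t) \<Longrightarrow> linf_functional G h = linf_functional G k"
  unfolding linf_functional_def by (intro ext) (auto intro!: infsum_cong)

lemma linf_norm_le:
  assumes f: "f \<in> ell1 G" and h: "\<And>t. t \<in> carrier G \<Longrightarrow> norm (h t) \<le> C"
  shows "norm (linf_functional G h f) \<le> C * ell1_norm G f"
proof -
  have b: "bounded (h ` carrier G)" using h by (auto simp: bounded_iff)
  have "norm (linf_functional G h f) \<le> (\<Sum>\<^sub>\<infinity>t\<in>carrier G. norm (f t * h t))"
    using f norm_infsum_bound[OF summable_ell1_mult(1)[OF f b]] by (simp add: linf_functional_def)
  also have "\<dots> \<le> (\<Sum>\<^sub>\<infinity>t\<in>carrier G. C * norm (f t))"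
    by (intro infsum_mono summable_ell1_mult[OF f b] summable_on_cmult_right ell1_abs[OF f])
      (auto simp: norm_mult mult.commute[of C] intro: mult_left_mono h)
  also have "\<dots> = C * ell1_norm G f"
    by (simp add: ell1_norm_def infsum_cmult_right')
  finally show ?thesis .
qed

lemma linf_in_dual:
  assumes h: "bounded (h ` carrier G)"
  shows "linf_functional G h \<in> dual (ell1 G) (ell1_norm G)"
proof -
  obtain C where C: "\<And>t. t \<in> carrier G \<Longrightarrow> norm (h t) \<le> C"
    using h by (auto simp: bounded_iff)
  have "linf_functional G h (f + g) = linf_functional G h f + linf_functional G h g"
    if "f \<in> ell1 G" "g \<in> ell1 G" for f g
    using that ell1_add[OF that] summable_ell1_mult(2)[OF that(1) h] summable_ell1_mult(2)[OF that(2) h]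
    by (simp add: linf_functional_def distrib_right infsum_add)
  moreover have "linf_functional G h (fscale c f) = c * linf_functional G h f"
    if "f \<in> ell1 G" for c f
    using that ell1_scale[OF that, of c]
    by (simp add: linf_functional_def fscale_def mult.assoc infsum_cmult_right')
  moreover have "\<exists>C. \<forall>f\<in>ell1 G. norm (linf_functional G h f) \<le> C * ell1_norm G f"
    using linf_norm_le[of _ G h C] C by blast
  ultimately show ?thesis
    by (auto simp: dual_def linf_functional_def)
qed

lemma dualD:
  assumes "\<phi> \<in> dual V n"
  shows "\<And>f g. f \<in> V \<Longrightarrow> g \<in> V \<Longrightarrow> \<phi> (f + g) = \<phi> f + \<phi> g"
    "\<And>c f. f \<in> V \<Longrightarrow> \<phi> (fscale c f) = c * \<phi> f"
    "\<And>f. f \<notin> V \<Longrightarrow> \<phi> f = 0"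
    "\<exists>C. \<forall>f\<in>V. norm (\<phi> f) \<le> C * n f"
  using assms by (auto simp: dual_def)

lemma dual_zero_arg:
  assumes "\<phi> \<in> dual (ell1 G) n"
  shows "\<phi> 0 = 0"
proof -
  have "fscale 0 (0::'a \<Rightarrow> complex) = 0" by (simp add: fscale_def fun_eq_iff)
  then show ?thesis using dualD(2)[OF assms ell1_zero, of 0] by simp
qed

lemma dual_ell1_bounded:
  assumes "\<phi> \<in> dual (ell1 G) (ell1_norm G)"
  shows "bounded ((\<lambda>t. \<phi> (point_mass t)) ` carrier G)"
proof -
  obtain C where C: "\<forall>f\<in>ell1 G. norm (\<phi> f) \<le> C * ell1_norm G f"
    using dualD(4)[OF assms] by blast
  have "norm (\<phi> (point_mass t)) \<le> C" if "t \<in> carrier G" for t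
    using C[rule_format, OF point_mass_ell1[OF that]] that by (simp add: ell1_norm_point_mass)
  then show ?thesis by (auto simp: bounded_iff)
qed

text \<open>The finite case of \<open>dual_eq_linf\<close>: such a function is a combination of
  point masses, so linearity evaluates \<open>\<phi>\<close> on it.\<close>

lemma dual_finite_support:
  assumes phi: "\<phi> \<in> dual (ell1 G) n" and "finite F" "F \<subseteq> carrier G"
  shows "(\<lambda>t. if t \<in> F then f t else 0) \<in> ell1 G \<and>
    \<phi> (\<lambda>t. if t \<in> F then f t else 0) = (\<Sum>t\<in>F. f t * \<phi> (point_mass t))"
  using assms(2,3)
proof (induction F rule: finite_induct)
  case empty
  then show ?case using ell1_zero[of G] dual_zero_arg[OF phi] by (simp add: zero_fun_def)
next
  case (insert x F)
  have eq: "(\<lambda>t. if t \<in> insert x F then f t else 0)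
      = fscale (f x) (point_mass x) + (\<lambda>t. if t \<in> F then f t else 0)"
    using insert by (auto simp: fun_eq_iff fscale_def point_mass_def)
  have x: "point_mass x \<in> ell1 G" using insert by (simp add: point_mass_ell1)
  show ?case unfolding eq
    using insert x dualD(1,2)[OF phi] by (simp add: ell1_add ell1_scale)
qed

text \<open>Finitely supported functions are dense: the part of \<open>f\<close> outside a finite
  \<open>F\<close> has norm \<open>ell1_norm G f\<close> minus a partial sum, which tends to 0, and
  boundedness of \<open>\<phi>\<close> passes this on to the values. With
  \<open>dual_ell1_bounded\<close>, every functional thus comes from a bounded function, so bidual
  elements need only be examined on the functionals \<open>linf_functional G h\<close>.\<close>

lemma dual_eq_linf:
  assumes phi: "\<phi> \<in> dual (ell1 G) (ell1_norm G)"
  shows "\<phi> = linf_functional G (\<lambda>t. \<phi> (point_mass t))"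
proof
  fix f
  show "\<phi> f = linf_functional G (\<lambda>t. \<phi> (point_mass t)) f"
  proof (cases "f \<in> ell1 G")
    case False
    then show ?thesis using dualD(3)[OF phi] by (simp add: linf_functional_def)
  next
    case f: True
    obtain C where C: "\<And>f. f\<in>ell1 G \<Longrightarrow> norm (\<phi> f) \<le> C * ell1_norm G f"
      using dualD(4)[OF phi] by blast
    have norm_lim: "((\<lambda>F. \<Sum>t\<in>F. norm (f t)) \<longlongrightarrow> ell1_norm G f) (finite_subsets_at_top (carrier G))"
      unfolding ell1_norm_def by (rule infsum_tendsto[OF ell1_abs[OF f]])
    have lim0: "((\<lambda>F. C * (ell1_norm G f - (\<Sum>t\<in>F. norm (f t)))) \<longlongrightarrow> 0)
        (finite_subsets_at_top (carrier G))"
      by (rule tendsto_eq_intros norm_lim refl | simp)+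
    have bound: "norm ((\<Sum>t\<in>F. f t * \<phi> (point_mass t)) - \<phi> f)
        \<le> C * (ell1_norm G f - (\<Sum>t\<in>F. norm (f t)))"
      if F: "finite F" "F \<subseteq> carrier G" for F
    proof -
      let ?a = "\<lambda>t. if t \<in> F then f t else 0" and ?b = "\<lambda>t. if t \<in> F then 0 else f t"
      have a: "?a \<in> ell1 G" "\<phi> ?a = (\<Sum>t\<in>F. f t * \<phi> (point_mass t))"
        using dual_finite_support[OF phi F, of f] by auto
      have b_eq: "?b = f + fscale (-1) ?a" by (auto simp: fscale_def fun_eq_iff)
      have b: "?b \<in> ell1 G" unfolding b_eq using f a by (intro ell1_add ell1_scale)
      have "f = ?a + ?b" by (auto simp: fun_eq_iff)
      then have "\<phi> f = \<phi> ?a + \<phi> ?b" using dualD(1)[OF phi a(1) b] by metis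
      then have "norm ((\<Sum>t\<in>F. f t * \<phi> (point_mass t)) - \<phi> f) = norm (\<phi> ?b)"
        using a(2) by (simp add: norm_minus_commute)
      also have "\<dots> \<le> C * ell1_norm G ?b" by (rule C[OF b])
      also have "ell1_norm G ?b = (\<Sum>\<^sub>\<infinity>t\<in>carrier G - F. norm (f t))"
        unfolding ell1_norm_def by (rule infsum_cong_neutral) auto
      also have "\<dots> = ell1_norm G f - (\<Sum>t\<in>F. norm (f t))"
        unfolding ell1_norm_def using infsum_Diff[OF ell1_abs[OF f] _ F(2)] F by simp
      finally show ?thesis .
    qed
    have "((\<lambda>F. (\<Sum>t\<in>F. f t * \<phi> (point_mass t)) - \<phi> f) \<longlongrightarrow> 0) (finite_subsets_at_top (carrier G))"
      by (rule Lim_null_comparison[OF _ lim0])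
        (auto intro!: eventually_finite_subsets_at_top_weakI bound)
    then have "((\<lambda>t. f t * \<phi> (point_mass t)) has_sum \<phi> f) (carrier G)"
      unfolding has_sum_def by (simp add: LIM_zero_iff)
    then show ?thesis using f by (simp add: linf_functional_def infsumI)
  qed
qed

lemma linf_point_mass:
  assumes "t \<in> carrier G"
  shows "linf_functional G h (point_mass t) = h t"
proof -
  have "linf_functional G h (point_mass t) = (\<Sum>\<^sub>\<infinity>s\<in>carrier G. point_mass t s * h s)"
    using point_mass_ell1[OF assms] by (simp add: linf_functional_def)
  also have "\<dots> = (\<Sum>\<^sub>\<infinity>s\<in>{t}. point_mass t s * h s)"
    by (rule infsum_cong_neutral) (use assms in \<open>auto simp: point_mass_def\<close>)
  finally show ?thesis by (simp add: point_mass_def)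
qed

text \<open>Together with \<open>norm_le_dual_norm\<close> this identifies the dual norm with the
  supremum norm. The dual norm is a bare \<open>Sup\<close>, so its set has to be shown nonempty
  here and bounded above there.\<close>

lemma dual_norm_linf_le:
  assumes h: "\<And>t. t \<in> carrier G \<Longrightarrow> norm (h t) \<le> C" and C: "0 \<le> C"
  shows "dual_norm (ell1 G) (ell1_norm G) (linf_functional G h) \<le> C"
  unfolding dual_norm_def
proof (rule cSup_least)
  have "ell1_norm G 0 = 0" by (simp add: ell1_norm_def)
  then show "{norm (linf_functional G h f) |f. f \<in> ell1 G \<and> ell1_norm G f \<le> 1} \<noteq> {}"
    using ell1_zero[of G] by (auto intro!: exI[of _ 0])
next
  fix x assume "x \<in> {norm (linf_functional G h f) |f. f \<in> ell1 G \<and> ell1_norm G f \<le> 1}"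
  then obtain f where f: "f \<in> ell1 G" "ell1_norm G f \<le> 1" "x = norm (linf_functional G h f)" by auto
  have "x \<le> C * ell1_norm G f" using linf_norm_le[OF f(1) h] f by simp
  also have "\<dots> \<le> C" using f(2) C by (simp add: mult_left_le)
  finally show "x \<le> C" .
qed

lemma norm_le_dual_norm:
  assumes phi: "\<phi> \<in> dual (ell1 G) (ell1_norm G)" and t: "t \<in> carrier G"
  shows "norm (\<phi> (point_mass t)) \<le> dual_norm (ell1 G) (ell1_norm G) \<phi>"
  unfolding dual_norm_def
proof (rule cSup_upper)
  show "norm (\<phi> (point_mass t)) \<in> {norm (\<phi> f) |f. f \<in> ell1 G \<and> ell1_norm G f \<le> 1}"
    using point_mass_ell1[OF t] ell1_norm_point_mass[OF t] by force
  obtain C where C: "\<And>f. f\<in>ell1 G \<Longrightarrow> norm (\<phi> f) \<le> C * ell1_norm G f"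
    using dualD(4)[OF phi] by blast
  have "norm (\<phi> f) \<le> \<bar>C\<bar>" if "f \<in> ell1 G" "ell1_norm G f \<le> 1" for f
  proof -
    \<comment> \<open>The constant supplied by \<open>dual\<close> may be negative; its absolute
      value is taken before the norm of \<open>f\<close> is replaced by 1.\<close>
    have "norm (\<phi> f) \<le> \<bar>C\<bar> * ell1_norm G f"
      using C[OF that(1)] ell1_norm_nonneg[of G f] by (smt (verit) mult_right_mono)
    also have "\<dots> \<le> \<bar>C\<bar>" using that by (simp add: mult_left_le)
    finally show ?thesis .
  qed
  then show "bdd_above {norm (\<phi> f) |f. f \<in> ell1 G \<and> ell1_norm G f \<le> 1}"
    by (auto simp: bdd_above_def)
qed

section \<open>Bidual elements as functionals on bounded functions\<close>

lemma linf_add: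
  assumes "bounded (h ` carrier G)" "bounded (k ` carrier G)"
  shows "linf_functional G (\<lambda>t. h t + k t) = linf_functional G h + linf_functional G k"
proof
  fix f
  show "linf_functional G (\<lambda>t. h t + k t) f = (linf_functional G h + linf_functional G k) f"
    using summable_ell1_mult(2)[of f G h] summable_ell1_mult(2)[of f G k] assms
    by (auto simp: linf_functional_def distrib_left infsum_add)
qed

lemma linf_scale: "linf_functional G (\<lambda>t. c * h t) = fscale c (linf_functional G h)"
  by (auto simp: linf_functional_def fscale_def fun_eq_iff mult.left_commute infsum_cmult_right')

lemma bounded_cmult:
  fixes h :: "'i \<Rightarrow> complex"
  assumes "bounded (h ` A)"
  shows "bounded ((\<lambda>t. c * h t) ` A)"
  using bounded_linear_image[OF assms bounded_linear_mult_right[of c]] by (simp add: image_image)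

text \<open>A way to build bidual elements from a bounded linear \<open>L\<close> on bounded
  functions. By \<open>dual_eq_linf\<close> each functional has the form
  \<open>linf_functional G h\<close>, where \<open>h\<close> consists of its values at point masses;
  \<open>bound\<close> is then used with \<open>B\<close> the dual norm.\<close>

lemma bidualI:
  fixes G :: "('a, 'b) monoid_scheme" and \<Phi> :: "'a bidual_elt"
  assumes add: "\<And>h k. bounded (h ` carrier G) \<Longrightarrow> bounded (k ` carrier G) \<Longrightarrow> L (\<lambda>t. h t + k t) = L h + L k"
    and scale: "\<And>c h. bounded (h ` carrier G) \<Longrightarrow> L (\<lambda>t. c * h t) = c * L h"
    and cong: "\<And>h k. (\<And>t. t \<in> carrier G \<Longrightarrow> h t = k t) \<Longrightarrow> L h = L k"
    and bound: "\<And>h B. (\<And>t. t \<in> carrier G \<Longrightarrow> norm (h t) \<le> B) \<Longrightarrow> 0 \<le> B \<Longrightarrow> norm (L h) \<le> C * B"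
    and Phi: "\<And>h. bounded (h ` carrier G) \<Longrightarrow> \<Phi> (linf_functional G h) = L h"
    and outside: "\<And>\<phi>. \<phi> \<notin> dual (ell1 G) (ell1_norm G) \<Longrightarrow> \<Phi> \<phi> = 0"
    and ne: "carrier G \<noteq> {}"
  shows "\<Phi> \<in> ell1_bidual G"
proof -
  let ?D = "dual (ell1 G) (ell1_norm G)"
  let ?h = "\<lambda>\<phi> t. \<phi> (point_mass t) :: complex"
  have PhiL: "\<Phi> \<phi> = L (?h \<phi>)" if "\<phi> \<in> ?D" for \<phi>
    using Phi[OF dual_ell1_bounded[OF that]] dual_eq_linf[OF that] by simp
  have "\<Phi> (\<phi> + \<psi>) = \<Phi> \<phi> + \<Phi> \<psi>" if "\<phi> \<in> ?D" "\<psi> \<in> ?D" for \<phi> \<psi>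
  proof -
    have "\<phi> + \<psi> = linf_functional G (\<lambda>t. ?h \<phi> t + ?h \<psi> t)"
      using linf_add[OF dual_ell1_bounded[OF that(1)] dual_ell1_bounded[OF that(2)]]
        dual_eq_linf[OF that(1)] dual_eq_linf[OF that(2)] by simp
    then have "\<Phi> (\<phi> + \<psi>) = \<Phi> (linf_functional G (\<lambda>t. ?h \<phi> t + ?h \<psi> t))" by simp
    also have "\<dots> = L (\<lambda>t. ?h \<phi> t + ?h \<psi> t)"
      by (rule Phi) (intro bounded_plus_comp dual_ell1_bounded that)
    finally show ?thesis using add that PhiL dual_ell1_bounded by metis
  qed
  moreover have "\<Phi> (fscale c \<phi>) = c * \<Phi> \<phi>" if "\<phi> \<in> ?D" for c \<phi>
  proof -
    have "fscale c \<phi> = linf_functional G (\<lambda>t. c * ?h \<phi> t)"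
      using linf_scale[of G c "?h \<phi>"] dual_eq_linf[OF that] by simp
    then have "\<Phi> (fscale c \<phi>) = \<Phi> (linf_functional G (\<lambda>t. c * ?h \<phi> t))" by simp
    also have "\<dots> = L (\<lambda>t. c * ?h \<phi> t)"
      by (rule Phi) (intro bounded_cmult dual_ell1_bounded that)

    finally show ?thesis using scale that PhiL dual_ell1_bounded by metis
  qed
  moreover have "norm (\<Phi> \<phi>) \<le> C * dual_norm (ell1 G) (ell1_norm G) \<phi>" if "\<phi> \<in> ?D" for \<phi>
  proof -
    \<comment> \<open>Any point of the carrier gives a value whose norm lies below the dual norm,
      which is therefore nonnegative.\<close>
    have "0 \<le> dual_norm (ell1 G) (ell1_norm G) \<phi>"
      using ne norm_le_dual_norm[OF that] norm_ge_zero order_trans by (metis ex_in_conv)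
    then show ?thesis
    using bound[of "?h \<phi>" "dual_norm (ell1 G) (ell1_norm G) \<phi>"] norm_le_dual_norm[OF that] PhiL[OF that] by auto
  qed
  ultimately show ?thesis using outside
    unfolding ell1_bidual_def bidual_def dual_def[of ?D] by blast
qed

lemma bidual_add:
  assumes "\<Phi> \<in> ell1_bidual G" "bounded (h ` carrier G)" "bounded (k ` carrier G)"
  shows "\<Phi> (linf_functional G (\<lambda>t. h t + k t)) = \<Phi> (linf_functional G h) + \<Phi> (linf_functional G k)"
  using assms dualD(1)[of \<Phi>] by (simp add: linf_add linf_in_dual ell1_bidual_def bidual_def)

lemma bidual_scale:
  assumes "\<Phi> \<in> ell1_bidual G" "bounded (h ` carrier G)"
  shows "\<Phi> (linf_functional G (\<lambda>t. c * h t)) = c * \<Phi> (linf_functional G h)"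
  using assms dualD(2)[of \<Phi>] by (simp add: linf_scale linf_in_dual ell1_bidual_def bidual_def)

text \<open>The counterpart of the premise \<open>bound\<close> of \<open>bidualI\<close>. Since
  \<open>dual_norm_linf_le\<close> replaces the dual norm by any bound \<open>B\<close> of
  \<open>h\<close>, later estimates never return to the dual norm.\<close>

lemma bidual_bound:
  assumes "\<Phi> \<in> ell1_bidual G"
  obtains C where "0 \<le> C" "\<And>h B. (\<And>t. t \<in> carrier G \<Longrightarrow> norm (h t) \<le> B) \<Longrightarrow> 0 \<le> B
     \<Longrightarrow> norm (\<Phi> (linf_functional G h)) \<le> C * B"
proof -
  obtain C where C: "\<forall>\<phi>\<in>dual (ell1 G) (ell1_norm G).
      norm (\<Phi> \<phi>) \<le> C * dual_norm (ell1 G) (ell1_norm G) \<phi>"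
    using dualD(4)[OF assms[unfolded ell1_bidual_def bidual_def]] by blast
  have "norm (\<Phi> (linf_functional G h)) \<le> \<bar>C\<bar> * B"
    if h: "\<And>t. t \<in> carrier G \<Longrightarrow> norm (h t) \<le> B" and B: "0 \<le> B" for h B
  proof -
    let ?n = "dual_norm (ell1 G) (ell1_norm G) (linf_functional G h)"
    have d: "linf_functional G h \<in> dual (ell1 G) (ell1_norm G)"
      using h by (intro linf_in_dual) (auto simp: bounded_iff)
    have n: "?n \<le> B" by (rule dual_norm_linf_le[OF h B])
    \<comment> \<open>The value at the zero function belongs to the set under the supremum.
      Nonnegativity then permits passing from \<open>C\<close> to
      \<open>\<bar>C\<bar>\<close>.\<close>
    have n0: "0 \<le> ?n"
      unfolding dual_norm_def
    proof (rule cSup_upper2[where x="norm (linf_functional G h 0)"])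
      have "ell1_norm G 0 = 0" by (simp add: ell1_norm_def)
      then show "norm (linf_functional G h 0) \<in> {norm (linf_functional G h f) |f. f \<in> ell1 G \<and> ell1_norm G f \<le> 1}"
        using ell1_zero[of G] by force
      have "norm (linf_functional G h f) \<le> B" if "f \<in> ell1 G" "ell1_norm G f \<le> 1" for f
        using order_trans[OF linf_norm_le[OF that(1), of h B] mult_left_le[OF that(2) B]] h by simp
      then show "bdd_above {norm (linf_functional G h f) |f. f \<in> ell1 G \<and> ell1_norm G f \<le> 1}"
        by (auto simp: bdd_above_def)
    qed simp
    have "norm (\<Phi> (linf_functional G h)) \<le> C * ?n" using C d by blast
    also have "\<dots> \<le> \<bar>C\<bar> * ?n" using n0 by (simp add: mult_right_mono)
    also have "\<dots> \<le> \<bar>C\<bar> * B" using n by (simp add: mult_left_mono)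
    finally show ?thesis .
  qed
  then show thesis using that[of "\<bar>C\<bar>"] by simp
qed

lemma bidual_outside:
  "\<Phi> \<in> ell1_bidual G \<Longrightarrow> \<phi> \<notin> dual (ell1 G) (ell1_norm G) \<Longrightarrow> \<Phi> \<phi> = 0"
  unfolding ell1_bidual_def bidual_def using dualD(3) by fast

lemma bidual_eqI:
  assumes "\<Phi> \<in> ell1_bidual G" "\<Psi> \<in> ell1_bidual G"
    "\<And>h. bounded (h ` carrier G) \<Longrightarrow> \<Phi> (linf_functional G h) = \<Psi> (linf_functional G h)"
  shows "\<Phi> = \<Psi>"
proof
  fix \<phi>
  show "\<Phi> \<phi> = \<Psi> \<phi>"
  proof (cases "\<phi> \<in> dual (ell1 G) (ell1_norm G)")
    case True
    then show ?thesis using assms(3)[OF dual_ell1_bounded[OF True]] dual_eq_linf[OF True] by simp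
  qed (use assms bidual_outside in metis)
qed

context group
begin

section \<open>The Arens product on the bidual of the group algebra\<close>

lemma bounded_translate:
  fixes h :: "'a \<Rightarrow> complex"
  assumes "bounded (h ` carrier G)" "s \<in> carrier G"
  shows "bounded ((\<lambda>u. h (s \<otimes> u)) ` carrier G)"
  using assms by (auto simp: bounded_iff)

lemma double_summable:
  fixes h :: "'a \<Rightarrow> complex"
  assumes a: "a \<in> ell1 G" and b: "b \<in> ell1 G" and h: "bounded (h ` carrier G)"
  shows "(\<lambda>p. norm (case p of (s, u) \<Rightarrow> a s * b u * h (s \<otimes> u))) summable_on carrier G \<times> carrier G"
proof -
  obtain C where C: "\<And>t. t \<in> carrier G \<Longrightarrow> norm (h t) \<le> C"
    using h by (auto simp: bounded_iff)
  have "(\<lambda>p. norm (case p of (s, u) \<Rightarrow> a s * b u)) summable_on carrier G \<times> carrier G"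
    unfolding Infinite_Sum.abs_summable_on_Sigma_iff
    by (auto simp: norm_mult infsum_cmult_right' infsum_nonneg
        intro!: summable_on_cmult_right summable_on_cmult_left ell1_abs a b)
  then have "(\<lambda>p. norm (case p of (s, u) \<Rightarrow> a s * b u) * C) summable_on carrier G \<times> carrier G"
    by (rule summable_on_cmult_left)
  then show ?thesis
    by (rule Infinite_Sum.abs_summable_on_comparison_test')
      (auto simp: norm_mult intro!: mult_left_mono C)
qed

text \<open>Fubini after the substitution \<open>u = inv s \<otimes> t\<close>; absolute convergence
  of the double series is \<open>double_summable\<close>.\<close>

lemma convolution_pairing:
  fixes h :: "'a \<Rightarrow> complex"
  assumes a: "a \<in> ell1 G" and b: "b \<in> ell1 G" and h: "bounded (h ` carrier G)"
  shows "convolution G a b \<in> ell1 G"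
    and "linf_functional G h (convolution G a b)
      = linf_functional G (\<lambda>u. \<Sum>\<^sub>\<infinity>s\<in>carrier G. a s * h (s \<otimes> u)) b"
proof -
  let ?C = "carrier G"
  have reindex: "(\<lambda>p. norm (case p of (t, s) \<Rightarrow> a s * b (inv s \<otimes> t) * k t)) summable_on ?C \<times> ?C"
    if "bounded (k ` ?C)" for k :: "'a \<Rightarrow> complex"
  proof -
    have "(\<lambda>p. norm (case p of (t, s) \<Rightarrow> a s * b (inv s \<otimes> t) * k t)) summable_on ?C \<times> ?C
      \<longleftrightarrow> (\<lambda>p. norm (case p of (s, u) \<Rightarrow> a s * b u * k (s \<otimes> u))) summable_on ?C \<times> ?C"
      by (rule summable_on_reindex_bij_witness[where i = "\<lambda>(s, u). (s \<otimes> u, s)" and j = "\<lambda>(t, s). (s, inv s \<otimes> t)"])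
        (auto simp: m_assoc[symmetric])
    then show ?thesis using double_summable[OF a b that] by simp
  qed
  \<comment> \<open>The choice \<open>k = 1\<close> yields absolute summability of the convolution
    itself.\<close>
  have one: "(\<lambda>p. norm (case p of (t, s) \<Rightarrow> a s * b (inv s \<otimes> t))) summable_on ?C \<times> ?C"
  proof -
    have "bounded ((\<lambda>_. 1 :: complex) ` ?C)" by (auto simp: bounded_iff)
    from reindex[OF this] show ?thesis by simp
  qed
  have inner: "(\<lambda>s. norm (a s * b (inv s \<otimes> t))) summable_on ?C" if "t \<in> ?C" for t
    using one that unfolding Infinite_Sum.abs_summable_on_Sigma_iff by auto
  have outer: "(\<lambda>t. \<Sum>\<^sub>\<infinity>s\<in>?C. norm (a s * b (inv s \<otimes> t))) summable_on ?C"
    using one unfolding Infinite_Sum.abs_summable_on_Sigma_iff by (auto simp: infsum_nonneg)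
  have "(\<lambda>t. norm (convolution G a b t)) summable_on ?C"
    using outer
    by (rule Infinite_Sum.abs_summable_on_comparison_test')
      (auto simp: convolution_def intro: norm_infsum_bound inner)
  then show conv: "convolution G a b \<in> ell1 G"
    by (simp add: ell1_def convolution_def)
  have s1: "(\<lambda>(t, s). a s * b (inv s \<otimes> t) * h t) summable_on ?C \<times> ?C"
    by (rule abs_summable_summable[OF reindex[OF h]])
  have s2: "(\<lambda>(s, u). a s * b u * h (s \<otimes> u)) summable_on ?C \<times> ?C"
    by (rule abs_summable_summable[OF double_summable[OF a b h]])
  have "linf_functional G h (convolution G a b)
      = (\<Sum>\<^sub>\<infinity>t\<in>?C. \<Sum>\<^sub>\<infinity>s\<in>?C. a s * b (inv s \<otimes> t) * h t)"
    using conv by (auto simp: linf_functional_def convolution_def infsum_cmult_left' intro!: infsum_cong)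
  also have "\<dots> = (\<Sum>\<^sub>\<infinity>(t, s)\<in>?C \<times> ?C. a s * b (inv s \<otimes> t) * h t)"
    using infsum_Sigma'_banach[OF s1] .
  also have "\<dots> = (\<Sum>\<^sub>\<infinity>(s, u)\<in>?C \<times> ?C. a s * b u * h (s \<otimes> u))"
    by (rule infsum_reindex_bij_witness[where i = "\<lambda>(s, u). (s \<otimes> u, s)" and j = "\<lambda>(t, s). (s, inv s \<otimes> t)"])
      (auto simp: m_assoc[symmetric])
  also have "\<dots> = (\<Sum>\<^sub>\<infinity>s\<in>?C. \<Sum>\<^sub>\<infinity>u\<in>?C. a s * b u * h (s \<otimes> u))"
    using infsum_Sigma'_banach[OF s2] by simp
  also have "\<dots> = (\<Sum>\<^sub>\<infinity>u\<in>?C. \<Sum>\<^sub>\<infinity>s\<in>?C. a s * b u * h (s \<otimes> u))"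
    by (rule infsum_swap_banach[OF s2])
  also have "\<dots> = (\<Sum>\<^sub>\<infinity>u\<in>?C. b u * (\<Sum>\<^sub>\<infinity>s\<in>?C. a s * h (s \<otimes> u)))"
    by (auto simp: infsum_cmult_right'[symmetric] mult_ac intro!: infsum_cong)
  also have "\<dots> = linf_functional G (\<lambda>u. \<Sum>\<^sub>\<infinity>s\<in>?C. a s * h (s \<otimes> u)) b"
    using b by (simp add: linf_functional_def)
  finally show "linf_functional G h (convolution G a b)
      = linf_functional G (\<lambda>u. \<Sum>\<^sub>\<infinity>s\<in>carrier G. a s * h (s \<otimes> u)) b" .
qed

lemma dual_act_linf:
  assumes a: "a \<in> ell1 G" and h: "bounded (h ` carrier G)"
  shows "dual_act (ell1 G) (convolution G) (linf_functional G h) a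
    = linf_functional G (\<lambda>u. \<Sum>\<^sub>\<infinity>s\<in>carrier G. a s * h (s \<otimes> u))"
  using convolution_pairing(2)[OF a _ h] by (auto simp: dual_act_def linf_functional_def)

lemma translate_sum_bound:
  fixes h :: "'a \<Rightarrow> complex"
  assumes a: "a \<in> ell1 G" and h: "\<And>t. t \<in> carrier G \<Longrightarrow> norm (h t) \<le> C" and u: "u \<in> carrier G"
  shows "norm (\<Sum>\<^sub>\<infinity>s\<in>carrier G. a s * h (s \<otimes> u)) \<le> C * ell1_norm G a"
  using linf_norm_le[OF a, of "\<lambda>s. h (s \<otimes> u)" C] h u a by (simp add: linf_functional_def)

lemma translate_sum_bounded:
  fixes h :: "'a \<Rightarrow> complex"
  assumes "a \<in> ell1 G" "bounded (h ` carrier G)"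
  shows "bounded ((\<lambda>u. \<Sum>\<^sub>\<infinity>s\<in>carrier G. a s * h (s \<otimes> u)) ` carrier G)"
proof -
  obtain C where C: "\<And>t. t \<in> carrier G \<Longrightarrow> norm (h t) \<le> C"
    using assms(2) by (auto simp: bounded_iff)
  have "norm (\<Sum>\<^sub>\<infinity>s\<in>carrier G. a s * h (s \<otimes> u)) \<le> C * ell1_norm G a" if "u \<in> carrier G" for u
    by (rule translate_sum_bound[OF assms(1) C that])
  then show ?thesis by (auto simp: bounded_iff)
qed

lemma point_mass_sum:
  fixes k :: "'a \<Rightarrow> complex"
  assumes "t \<in> carrier G"
  shows "(\<Sum>\<^sub>\<infinity>s\<in>carrier G. point_mass t s * k s) = k t"
  using linf_point_mass[OF assms, of k] point_mass_ell1[OF assms] by (simp add: linf_functional_def)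

text \<open>The left side is a bounded linear functional of \<open>a\<close>, so by
  \<open>dual_eq_linf\<close> its values at point masses determine it. At
  \<open>point_mass t\<close> the sum over \<open>s\<close> collapses to the translate
  \<open>h (t \<otimes> u)\<close>.\<close>

lemma bidual_act_linf:
  assumes Phi: "\<Phi> \<in> ell1_bidual G" and h: "bounded (h ` carrier G)"
  shows "bidual_act (ell1 G) (convolution G) \<Phi> (linf_functional G h)
    = linf_functional G (\<lambda>t. \<Phi> (linf_functional G (\<lambda>u. h (t \<otimes> u))))" (is "?\<psi> = _")
proof -
  let ?S = "\<lambda>a u. \<Sum>\<^sub>\<infinity>s\<in>carrier G. a s * h (s \<otimes> u)"
  have psi: "?\<psi> a = \<Phi> (linf_functional G (?S a))" if "a \<in> ell1 G" for a
    using that by (simp add: bidual_act_def dual_act_linf h)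
  have summ: "(\<lambda>s. a s * h (s \<otimes> u)) summable_on carrier G" if "a \<in> ell1 G" "u \<in> carrier G" for a u
    using that h by (intro summable_ell1_mult) (auto simp: bounded_iff)
  have add: "?\<psi> (a + b) = ?\<psi> a + ?\<psi> b" if ab: "a \<in> ell1 G" "b \<in> ell1 G" for a b
  proof -
    have "linf_functional G (?S (a + b)) = linf_functional G (\<lambda>u. ?S a u + ?S b u)"
      by (rule linf_cong) (simp add: distrib_right infsum_add summ ab)
    then show ?thesis
      using ab by (simp add: psi ell1_add bidual_add[OF Phi] translate_sum_bounded h)
  qed
  have scale: "?\<psi> (fscale c a) = c * ?\<psi> a" if "a \<in> ell1 G" for c a
  proof -
    have "linf_functional G (?S (fscale c a)) = linf_functional G (\<lambda>u. c * ?S a u)"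
      by (rule linf_cong) (simp add: fscale_def mult.assoc infsum_cmult_right')
    then show ?thesis
      using that by (simp add: psi ell1_scale bidual_scale[OF Phi] translate_sum_bounded h)
  qed
  obtain B where B: "\<And>t. t \<in> carrier G \<Longrightarrow> norm (h t) \<le> B"
    using h by (auto simp: bounded_iff)
  then have B0: "0 \<le> B" using norm_ge_zero order_trans by blast
  obtain C where C: "0 \<le> C" "\<And>h B. (\<And>t. t \<in> carrier G \<Longrightarrow> norm (h t) \<le> B) \<Longrightarrow> 0 \<le> B
     \<Longrightarrow> norm (\<Phi> (linf_functional G h)) \<le> C * B"
    by (rule bidual_bound[OF Phi]) blast
  have "norm (?\<psi> a) \<le> C * B * ell1_norm G a" if a: "a \<in> ell1 G" for a
    using C(2)[of "?S a" "B * ell1_norm G a", OF translate_sum_bound[OF a, of h B, OF B]] B0 ell1_norm_nonneg[of G a]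
    by (simp add: psi a mult.assoc)
  then have dual: "?\<psi> \<in> dual (ell1 G) (ell1_norm G)"
    using add scale by (auto simp: dual_def bidual_act_def)
  have "?\<psi> (point_mass t) = \<Phi> (linf_functional G (\<lambda>u. h (t \<otimes> u)))" if "t \<in> carrier G" for t
    using that by (simp add: psi point_mass_ell1 point_mass_sum[of t "\<lambda>s. h (s \<otimes> _)"])
  then show ?thesis
    using dual_eq_linf[OF dual] by (metis (no_types, lifting) linf_cong)
qed

text \<open>The constant is uniform in \<open>t\<close> because a left translate of \<open>h\<close>
  obeys the same bound as \<open>h\<close>. This is what keeps the inner function of an Arens
  product bounded.\<close>

lemma bidual_translates_bound:
  assumes Phi: "\<Phi> \<in> ell1_bidual G"
  obtains C where "0 \<le> C" "\<And>h B t. (\<And>t. t \<in> carrier G \<Longrightarrow> norm (h t) \<le> B) \<Longrightarrow> 0 \<le> B \<Longrightarrow> t \<in> carrier G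
     \<Longrightarrow> norm (\<Phi> (linf_functional G (\<lambda>u. h (t \<otimes> u)))) \<le> C * B"
proof -
  obtain C where "0 \<le> C" and C: "\<And>h B. (\<And>t. t \<in> carrier G \<Longrightarrow> norm (h t) \<le> B) \<Longrightarrow> 0 \<le> B
     \<Longrightarrow> norm (\<Phi> (linf_functional G h)) \<le> C * B"
    by (rule bidual_bound[OF Phi]) blast
  show thesis
  proof (rule that[OF \<open>0 \<le> C\<close>])
    fix h :: "'a \<Rightarrow> complex" and B t
    assume h: "\<And>t. t \<in> carrier G \<Longrightarrow> norm (h t) \<le> B" and B: "0 \<le> B" and t: "t \<in> carrier G"
    have "norm (h (t \<otimes> u)) \<le> B" if "u \<in> carrier G" for u
      by (rule h[OF m_closed[OF t that]])
    then show "norm (\<Phi> (linf_functional G (\<lambda>u. h (t \<otimes> u)))) \<le> C * B"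
      by (rule C[OF _ B])
  qed
qed

lemma bidual_translates_bounded:
  assumes Phi: "\<Phi> \<in> ell1_bidual G" and h: "bounded (h ` carrier G)"
  shows "bounded ((\<lambda>t. \<Phi> (linf_functional G (\<lambda>u. h (t \<otimes> u)))) ` carrier G)"
proof -
  obtain B where B: "\<And>t. t \<in> carrier G \<Longrightarrow> norm (h t) \<le> B"
    using h by (auto simp: bounded_iff)
  then have B0: "0 \<le> B" using norm_ge_zero order_trans by blast
  obtain C where "0 \<le> C" and C: "\<And>h B t. (\<And>t. t \<in> carrier G \<Longrightarrow> norm (h t) \<le> B) \<Longrightarrow> 0 \<le> B \<Longrightarrow> t \<in> carrier G
     \<Longrightarrow> norm (\<Phi> (linf_functional G (\<lambda>u. h (t \<otimes> u)))) \<le> C * B"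
    by (rule bidual_translates_bound[OF Phi]) blast
  have "norm (\<Phi> (linf_functional G (\<lambda>u. h (t \<otimes> u)))) \<le> C * B" if "t \<in> carrier G" for t
    by (rule C[OF B B0 that])
  then show ?thesis by (auto simp: bounded_iff)
qed

section \<open>The Arens product as an iterated functional\<close>

lemma arens_linf:
  assumes "\<Phi> \<in> ell1_bidual G" and "bounded (h ` carrier G)"
  shows "arens G \<Psi> \<Phi> (linf_functional G h)
    = \<Psi> (linf_functional G (\<lambda>t. \<Phi> (linf_functional G (\<lambda>u. h (t \<otimes> u)))))"
  using assms by (simp add: arens_def arens_product_def linf_in_dual bidual_act_linf)

lemma arens_bidual:
  assumes Psi: "\<Psi> \<in> ell1_bidual G" and Phi: "\<Phi> \<in> ell1_bidual G"
  shows "arens G \<Psi> \<Phi> \<in> ell1_bidual G"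
proof -
  let ?P = "\<lambda>h t. \<Phi> (linf_functional G (\<lambda>u. h (t \<otimes> u)))"
  obtain C where C: "0 \<le> C" "\<And>h B t. (\<And>t. t \<in> carrier G \<Longrightarrow> norm (h t) \<le> B) \<Longrightarrow> 0 \<le> B \<Longrightarrow> t \<in> carrier G
     \<Longrightarrow> norm (?P h t) \<le> C * B"
    by (rule bidual_translates_bound[OF Phi]) blast
  obtain D where D: "0 \<le> D" "\<And>h B. (\<And>t. t \<in> carrier G \<Longrightarrow> norm (h t) \<le> B) \<Longrightarrow> 0 \<le> B
     \<Longrightarrow> norm (\<Psi> (linf_functional G h)) \<le> D * B"
    by (rule bidual_bound[OF Psi]) blast
  show ?thesis
  proof (rule bidualI[where L = "\<lambda>h. \<Psi> (linf_functional G (?P h))" and C = "D * C"])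
    fix h k :: "'a \<Rightarrow> complex"
    assume hk: "bounded (h ` carrier G)" "bounded (k ` carrier G)"
    have "linf_functional G (?P (\<lambda>t. h t + k t)) = linf_functional G (\<lambda>t. ?P h t + ?P k t)"
      by (rule linf_cong) (simp add: bidual_add[OF Phi] bounded_translate hk)
    then show "\<Psi> (linf_functional G (?P (\<lambda>t. h t + k t))) = \<Psi> (linf_functional G (?P h)) + \<Psi> (linf_functional G (?P k))"
      by (simp add: bidual_add[OF Psi] bidual_translates_bounded Phi hk)
  next
    fix c and h :: "'a \<Rightarrow> complex"
    assume h: "bounded (h ` carrier G)"
    have "linf_functional G (?P (\<lambda>t. c * h t)) = linf_functional G (\<lambda>t. c * ?P h t)"
      by (rule linf_cong) (simp add: bidual_scale[OF Phi] bounded_translate h)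
    then show "\<Psi> (linf_functional G (?P (\<lambda>t. c * h t))) = c * \<Psi> (linf_functional G (?P h))"
      by (simp add: bidual_scale[OF Psi] bidual_translates_bounded Phi h)
  next
    fix h k :: "'a \<Rightarrow> complex"
    assume hk: "\<And>t. t \<in> carrier G \<Longrightarrow> h t = k t"
    have "linf_functional G (?P h) = linf_functional G (?P k)"
      by (intro linf_cong arg_cong[where f = \<Phi>]) (simp add: hk)
    then show "\<Psi> (linf_functional G (?P h)) = \<Psi> (linf_functional G (?P k))" by simp
  next
    fix h :: "'a \<Rightarrow> complex" and B
    assume "\<And>t. t \<in> carrier G \<Longrightarrow> norm (h t) \<le> B" "0 \<le> B"
    then have "\<And>t. t \<in> carrier G \<Longrightarrow> norm (?P h t) \<le> C * B" "0 \<le> C * B" using C by auto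
    then show "norm (\<Psi> (linf_functional G (?P h))) \<le> D * C * B" 
      using D(2)[of "?P h" "C * B"] by (simp add: mult.assoc)
  next
    show "arens G \<Psi> \<Phi> \<phi> = 0" if "\<phi> \<notin> dual (ell1 G) (ell1_norm G)" for \<phi>
      using that by (simp add: arens_def arens_product_def)
  next
    show "arens G \<Psi> \<Phi> (linf_functional G h) = \<Psi> (linf_functional G (?P h))"
      if "bounded (h ` carrier G)" for h
      using Phi that by (rule arens_linf)
  qed blast
qed

section \<open>Point masses and translation invariance\<close>

lemma delta_linf:
  assumes "s \<in> carrier G" "bounded (h ` carrier G)"
  shows "delta G s (linf_functional G h) = h s"
  using assms by (simp add: delta_def canonical_embedding_def linf_in_dual linf_point_mass)

lemma delta_bidual:
  assumes s: "s \<in> carrier G"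
  shows "delta G s \<in> ell1_bidual G"
  by (rule bidualI[where L = "\<lambda>h. h s" and C = 1])
    (use s in \<open>auto simp: delta_linf\<close>, auto simp: delta_def canonical_embedding_def)

lemma arens_delta:
  assumes "s \<in> carrier G" "\<Phi> \<in> ell1_bidual G" "bounded (h ` carrier G)"
  shows "arens G (delta G s) \<Phi> (linf_functional G h) = \<Phi> (linf_functional G (\<lambda>u. h (s \<otimes> u)))"
  using assms by (simp add: arens_linf delta_linf bidual_translates_bounded)

lemma bounded_const: "bounded ((\<lambda>_. c :: complex) ` A)"
  by (auto simp: bounded_iff)

lemma invariant_difference_linf:
  assumes "\<Gamma> \<in> invariant_differences G"
  shows "\<Gamma> \<in> ell1_bidual G" "\<Gamma> (one_functional G) = 0"
    "\<And>s h. s \<in> carrier G \<Longrightarrow> bounded (h ` carrier G) \<Longrightarrow>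
      \<Gamma> (linf_functional G (\<lambda>u. h (s \<otimes> u))) = \<Gamma> (linf_functional G h)"
proof -
  show *: "\<Gamma> \<in> ell1_bidual G" "\<Gamma> (one_functional G) = 0"
    using assms by (auto simp: invariant_differences_def)
  fix s and h :: "'a \<Rightarrow> complex" assume "s \<in> carrier G" "bounded (h ` carrier G)"
  then show "\<Gamma> (linf_functional G (\<lambda>u. h (s \<otimes> u))) = \<Gamma> (linf_functional G h)"
    using arens_delta[of s \<Gamma> h] * assms by (simp add: invariant_differences_def)
qed

lemma invariant_differenceI:
  assumes "\<Gamma> \<in> ell1_bidual G" "\<Gamma> (one_functional G) = 0"
    "\<And>s h. s \<in> carrier G \<Longrightarrow> bounded (h ` carrier G) \<Longrightarrow>
      \<Gamma> (linf_functional G (\<lambda>u. h (s \<otimes> u))) = \<Gamma> (linf_functional G h)"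
  shows "\<Gamma> \<in> invariant_differences G"
proof -
  have "arens G (delta G s) \<Gamma> = \<Gamma>" if "s \<in> carrier G" for s
    by (rule bidual_eqI) (use that assms in \<open>auto simp: arens_bidual delta_bidual arens_delta\<close>)
  then show ?thesis using assms by (simp add: invariant_differences_def)
qed

text \<open>By invariance \<open>\<Gamma>\<close> takes the same value on all fibres of \<open>q\<close>, and these values sum to \<open>\<langle>\<Gamma>, 1\<rangle> = 0\<close>.\<close>

lemma invariant_difference_finite_image:
  fixes f :: "'a \<Rightarrow> complex"
  assumes Gam: "\<Gamma> \<in> invariant_differences G"
    and fin: "finite (q ` carrier G)"
    and equiv: "\<And>s t h. s \<in> carrier G \<Longrightarrow> t \<in> carrier G \<Longrightarrow> h \<in> carrier G \<Longrightarrow> q s = q t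
      \<Longrightarrow> q (h \<otimes> s) = q (h \<otimes> t)"
    and f: "\<And>s t. s \<in> carrier G \<Longrightarrow> t \<in> carrier G \<Longrightarrow> q s = q t \<Longrightarrow> f s = f t"
  shows "\<Gamma> (linf_functional G f) = 0"
proof -
  note inv = invariant_difference_linf[OF Gam]
  let ?X = "q ` carrier G"
  define I where "I x s = (if q s = x then 1 else (0::complex))" for x s
  have bI: "bounded (I x ` carrier G)" for x by (auto simp: bounded_iff I_def intro!: exI[of _ 1])
  let ?g = "\<Gamma> (linf_functional G (I (q \<one>)))"
  have I_eq: "\<Gamma> (linf_functional G (I x)) = ?g" if "x \<in> ?X" for x
  proof -
    obtain a where a: "a \<in> carrier G" "x = q a" using \<open>x \<in> ?X\<close> by blast
    \<comment> \<open>Multiplication by \<open>a\<close> on the left carries the fibre over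
      \<open>q \<one>\<close> into the fibre over \<open>q a\<close>, and \<open>inv a\<close>
      carries it back, since \<open>q\<close> is compatible with left multiplication.\<close>
    have iff: "q (a \<otimes> s) = q a \<longleftrightarrow> q s = q \<one>" if s: "s \<in> carrier G" for s
    proof
      assume "q (a \<otimes> s) = q a"
      then have "q (inv a \<otimes> (a \<otimes> s)) = q (inv a \<otimes> a)" using equiv[of "a \<otimes> s" a "inv a"] a s by simp
      then show "q s = q \<one>" using a s by (simp add: m_assoc[symmetric])
    next
      assume "q s = q \<one>"
      then have "q (a \<otimes> s) = q (a \<otimes> \<one>)" using equiv[of s \<one> a] a s by simp
      then show "q (a \<otimes> s) = q a" using a by simp
    qed
    have "\<Gamma> (linf_functional G (I x)) = \<Gamma> (linf_functional G (\<lambda>s. I x (a \<otimes> s)))"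
      by (rule inv(3)[OF a(1) bI, symmetric])
    also have "linf_functional G (\<lambda>s. I x (a \<otimes> s)) = linf_functional G (I (q \<one>))"
      by (rule linf_cong) (simp add: a iff I_def)
    finally show ?thesis .
  qed
  have sum: "bounded ((\<lambda>s. \<Sum>x\<in>Y. c x * I x s) ` carrier G) \<and>
      \<Gamma> (linf_functional G (\<lambda>s. \<Sum>x\<in>Y. c x * I x s)) = (\<Sum>x\<in>Y. c x) * ?g"
    if "finite Y" "Y \<subseteq> ?X" for Y c
    using that
  proof (induction Y rule: finite_induct)
    case empty
    then show ?case
      using bidual_scale[OF inv(1) bounded_const, of 0 0] by (simp add: bounded_const)
  next
    case (insert x Y)
    then have *: "bounded ((\<lambda>s. \<Sum>x\<in>Y. c x * I x s) ` carrier G)"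
      "\<Gamma> (linf_functional G (\<lambda>s. \<Sum>x\<in>Y. c x * I x s)) = (\<Sum>x\<in>Y. c x) * ?g" by auto
    have b: "bounded ((\<lambda>s. c x * I x s) ` carrier G)" by (rule bounded_cmult[OF bI])
    have eq: "(\<lambda>s. \<Sum>x\<in>insert x Y. c x * I x s) = (\<lambda>s. c x * I x s + (\<Sum>x\<in>Y. c x * I x s))"
      using insert.hyps by simp
    have "\<Gamma> (linf_functional G (\<lambda>s. c x * I x s)) = c x * ?g"
      using bidual_scale[OF inv(1) bI] I_eq[of x] insert.prems by auto
    then show ?case
      unfolding eq bidual_add[OF inv(1) b *(1)] using * b insert.hyps
      by (auto simp: distrib_right intro!: bounded_plus_comp)
  qed
  \<comment> \<open>\<open>F\<close> is \<open>f\<close> passed to the set of fibres: any chosen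
    point of a fibre gives the common value.\<close>
  define F where "F x = f (SOME s. s \<in> carrier G \<and> q s = x)" for x
  have F: "F (q s) = f s" if "s \<in> carrier G" for s
  proof -
    have "(SOME r. r \<in> carrier G \<and> q r = q s) \<in> carrier G \<and> q (SOME r. r \<in> carrier G \<and> q r = q s) = q s"
      by (rule someI[of _ s]) (simp add: that)
    then show ?thesis unfolding F_def using f that by blast
  qed
  have pick: "(\<Sum>x\<in>?X. c x * I x s) = c (q s)" if "s \<in> carrier G" for c s
    using that fin by (simp add: I_def if_distrib[of "(*) _"] cong: if_cong)
  have "one_functional G = linf_functional G (\<lambda>s. \<Sum>x\<in>?X. 1 * I x s)"
    by (rule linf_cong) (simp only: pick)
  then have "(\<Sum>x\<in>?X. 1) * ?g = 0"
    using sum[OF fin subset_refl, of "\<lambda>_. 1"] inv(2) by metis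
  then have g0: "?g = 0" using fin by (auto simp: card_gt_0_iff)
  have "linf_functional G f = linf_functional G (\<lambda>s. \<Sum>x\<in>?X. F x * I x s)"
    by (rule linf_cong) (simp only: pick F)
  then show ?thesis using sum[OF fin subset_refl, of F] g0 by simp
qed

lemma invariant_difference_finite_group:
  assumes "finite (carrier G)" "\<Gamma> \<in> invariant_differences G"
  shows "\<Gamma> = 0"
proof
  fix \<phi>
  show "\<Gamma> \<phi> = 0 \<phi>"
  proof (cases "\<phi> \<in> dual (ell1 G) (ell1_norm G)")
    case True
    have "\<Gamma> (linf_functional G (\<lambda>t. \<phi> (point_mass t))) = 0"
      \<comment> \<open>For \<open>q = id\<close> the fibres are points, so every function is
        constant on them.\<close>
      by (rule invariant_difference_finite_image[where q = id]) (use assms in auto)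
    then show ?thesis using dual_eq_linf[OF True] by simp
  qed (use bidual_outside invariant_difference_linf(1)[OF assms(2)] in auto)
qed

section \<open>Annihilation by finite index subgroups\<close>

lemma subnormal_chain_subgroup:
  assumes "K 0 = carrier G" and "\<And>i. i < n \<Longrightarrow> K (Suc i) \<lhd> G\<lparr>carrier := K i\<rparr>" and "i \<le> n"
  shows "subgroup (K i) G"
  using \<open>i \<le> n\<close>
proof (induction i)
  case 0
  then show ?case using assms(1) subgroup_self by simp
next
  case (Suc i)
  then show ?case using assms(2)[of i] by (auto intro: incl_subgroup normal_imp_subgroup)
qed

lemma subnormal_imp_subgroup: "subnormal H G \<Longrightarrow> subgroup H G"
  unfolding subnormal_def by (metis subnormal_chain_subgroup order_refl)

lemma ell1_subgroup_subset:
  assumes "subgroup H G"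
  shows "ell1 (G\<lparr>carrier := H\<rparr>) \<subseteq> ell1 G"
proof
  fix f assume f: "f \<in> ell1 (G\<lparr>carrier := H\<rparr>)"
  have "(\<lambda>t. norm (f t)) summable_on carrier G \<longleftrightarrow> (\<lambda>t. norm (f t)) summable_on H"
    by (rule summable_on_cong_neutral) (use f subgroup.subset[OF assms] in \<open>auto simp: ell1_def\<close>)
  then show "f \<in> ell1 G" using f subgroup.subset[OF assms] by (auto simp: ell1_def)
qed

text \<open>The adjoint of extension by zero is restriction. As functions live on the whole type,
  restricting leaves \<open>h\<close> as it is and only shrinks the carrier.\<close>

lemma bidual_inclusion_linf:
  assumes H: "subgroup H G" and h: "bounded (h ` carrier G)"
  shows "bidual_inclusion G H \<Gamma> (linf_functional G h) = \<Gamma> (linf_functional (G\<lparr>carrier := H\<rparr>) h)"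
proof -
  have "linf_functional G h f = (\<Sum>\<^sub>\<infinity>t\<in>H. f t * h t)" if f: "f \<in> ell1 (G\<lparr>carrier := H\<rparr>)" for f
  proof -
    have "linf_functional G h f = (\<Sum>\<^sub>\<infinity>t\<in>carrier G. f t * h t)"
      using f ell1_subgroup_subset[OF H] by (auto simp: linf_functional_def)
    also have "\<dots> = (\<Sum>\<^sub>\<infinity>t\<in>H. f t * h t)"
      by (rule infsum_cong_neutral) (use f subgroup.subset[OF H] in \<open>auto simp: ell1_def\<close>)
    finally show ?thesis .
  qed
  then have "adjoint_map (ell1 (G\<lparr>carrier := H\<rparr>)) id (linf_functional G h) = linf_functional (G\<lparr>carrier := H\<rparr>) h"
    by (intro ext) (simp add: adjoint_map_def linf_functional_def[of "G\<lparr>carrier := H\<rparr>"])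
  then show ?thesis using linf_in_dual[OF h] by (simp add: bidual_inclusion_def adjoint_map_def[of "dual _ _"])
qed

lemma bounded_subgroup:
  assumes "subgroup H G" "bounded (h ` carrier G)"
  shows "bounded (h ` carrier (G\<lparr>carrier := H\<rparr>))"
  by (rule bounded_subset[OF assms(2)]) (use subgroup.subset[OF assms(1)] in auto)

lemma bidual_inclusion_bidual:
  assumes H: "subgroup H G" and Gam: "\<Gamma> \<in> ell1_bidual (G\<lparr>carrier := H\<rparr>)"
  shows "bidual_inclusion G H \<Gamma> \<in> ell1_bidual G"
proof -
  let ?H = "G\<lparr>carrier := H\<rparr>"
  obtain C where C: "\<And>h B. (\<And>t. t \<in> carrier ?H \<Longrightarrow> norm (h t) \<le> B) \<Longrightarrow> 0 \<le> B
     \<Longrightarrow> norm (\<Gamma> (linf_functional ?H h)) \<le> C * B"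
    by (rule bidual_bound[OF Gam]) blast
  show ?thesis
  proof (rule bidualI[where L = "\<lambda>h. \<Gamma> (linf_functional ?H h)" and C = C])
    fix h :: "'a \<Rightarrow> complex" and B :: real
    assume h: "\<And>t. t \<in> carrier G \<Longrightarrow> norm (h t) \<le> B" and B: "0 \<le> B"
    have "norm (h t) \<le> B" if "t \<in> carrier ?H" for t
      by (rule h) (use that subgroup.subset[OF H] in auto)
    then show "norm (\<Gamma> (linf_functional ?H h)) \<le> C * B" by (rule C[OF _ B])
  next
    fix h k :: "'a \<Rightarrow> complex"
    assume hk: "\<And>t. t \<in> carrier G \<Longrightarrow> h t = k t"
    have "linf_functional ?H h = linf_functional ?H k"
      by (rule linf_cong, rule hk) (use subgroup.subset[OF H] in auto)
    then show "\<Gamma> (linf_functional ?H h) = \<Gamma> (linf_functional ?H k)" by simp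
  next
    show "bidual_inclusion G H \<Gamma> (linf_functional G h) = \<Gamma> (linf_functional ?H h)"
      if "bounded (h ` carrier G)" for h
      by (rule bidual_inclusion_linf[OF H that])
  next
    show "bidual_inclusion G H \<Gamma> \<phi> = 0" if "\<phi> \<notin> dual (ell1 G) (ell1_norm G)" for \<phi>
      using that by (simp add: bidual_inclusion_def adjoint_map_def)
  qed (auto intro!: bidual_add[OF Gam] bidual_scale[OF Gam] bounded_subgroup[OF H, simplified])
qed

lemma D_snE:
  assumes "\<Gamma> \<in> D_sn G"
  obtains H \<Delta> where "subnormal H G" "subgroup H G" "group (G\<lparr>carrier := H\<rparr>)"
    "\<Delta> \<in> invariant_differences (G\<lparr>carrier := H\<rparr>)" "\<Gamma> = bidual_inclusion G H \<Delta>"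
    "\<Gamma> \<in> ell1_bidual G"
proof -
  obtain H \<Delta> where *: "subnormal H G"
    "\<Delta> \<in> invariant_differences (G\<lparr>carrier := H\<rparr>)" "\<Gamma> = bidual_inclusion G H \<Delta>"
    using assms by (auto simp: D_sn_def)
  moreover have H: "subgroup H G" using * subnormal_imp_subgroup by simp
  moreover have "group (G\<lparr>carrier := H\<rparr>)" by (rule subgroup_imp_group[OF H])
  ultimately show thesis
    using that group.invariant_difference_linf(1) bidual_inclusion_bidual by blast
qed

section \<open>Products that vanish over a normal subgroup of finite index\<close>

lemma bidual_zero_fun: "\<Phi> \<in> ell1_bidual G \<Longrightarrow> \<Phi> (linf_functional G (\<lambda>_. 0)) = 0"
  using bidual_scale[of \<Phi> G "\<lambda>_. 0" 0] by (simp add: bounded_const)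

text \<open>On \<open>H\<close>, the function
  \<open>v \<mapsto> h (t \<otimes> k \<otimes> v)\<close> is the left translate by \<open>k\<close>
  of \<open>v \<mapsto> h (t \<otimes> v)\<close>, which \<open>\<Gamma>\<close> does not
  distinguish from it. So pairing with the translates of \<open>h\<close> gives a function constant
  on left cosets of \<open>H\<close>.\<close>

lemma D_sn_coset_invariant:
  fixes h :: "'a \<Rightarrow> complex"
  assumes H: "subgroup H G" and Gam: "\<Gamma> \<in> invariant_differences (G\<lparr>carrier := H\<rparr>)"
    and h: "bounded (h ` carrier G)" and t: "t \<in> carrier G" and k: "k \<in> H"
  shows "bidual_inclusion G H \<Gamma> (linf_functional G (\<lambda>v. h (t \<otimes> k \<otimes> v)))
    = bidual_inclusion G H \<Gamma> (linf_functional G (\<lambda>v. h (t \<otimes> v)))"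
proof -
  interpret H: group "G\<lparr>carrier := H\<rparr>" by (rule subgroup_imp_group[OF H])
  have kG: "k \<in> carrier G" using k H subgroup.subset by blast
  have b: "bounded ((\<lambda>v. h (t \<otimes> v)) ` carrier G)" by (rule bounded_translate[OF h t])
  have eq: "linf_functional (G\<lparr>carrier := H\<rparr>) (\<lambda>v. h (t \<otimes> k \<otimes> v))
    = linf_functional (G\<lparr>carrier := H\<rparr>) (\<lambda>v. h (t \<otimes> (k \<otimes> v)))"
    by (rule linf_cong) (use t kG subgroup.subset[OF H] in \<open>auto simp: m_assoc\<close>)
  have "bidual_inclusion G H \<Gamma> (linf_functional G (\<lambda>v. h (t \<otimes> k \<otimes> v)))
    = \<Gamma> (linf_functional (G\<lparr>carrier := H\<rparr>) (\<lambda>v. h (t \<otimes> (k \<otimes> v))))"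
    using bidual_inclusion_linf[OF H bounded_translate[OF h m_closed[OF t kG]]] eq by simp
  also have "\<dots> = \<Gamma> (linf_functional (G\<lparr>carrier := H\<rparr>) (\<lambda>v. h (t \<otimes> v)))"
    using H.invariant_difference_linf(3)[OF Gam, of k "\<lambda>v. h (t \<otimes> v)"] bounded_subgroup[OF H b] k by simp
  also have "\<dots> = bidual_inclusion G H \<Gamma> (linf_functional G (\<lambda>v. h (t \<otimes> v)))"
    by (rule bidual_inclusion_linf[OF H b, symmetric])
  finally show ?thesis .
qed

text \<open>\<open>F\<close> factors through the finite set of cosets of \<open>N\<close>. Normality
  makes left multiplication well defined on the right cosets \<open>N #> s\<close>, so
  \<open>invariant_difference_finite_image\<close> applies to the coset map restricted to
  \<open>H\<close>.\<close>

lemma invariant_difference_coset_function: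
  fixes F :: "'a \<Rightarrow> complex"
  assumes N: "N \<lhd> G" and fin: "finite (rcosets N)"
    and H: "subgroup H G" and Gam: "\<Gamma> \<in> invariant_differences (G\<lparr>carrier := H\<rparr>)"
    and F: "bounded (F ` carrier G)"
    and inv: "\<And>n t. n \<in> N \<Longrightarrow> t \<in> carrier G \<Longrightarrow> F (n \<otimes> t) = F t"
  shows "bidual_inclusion G H \<Gamma> (linf_functional G F) = 0"
proof -
  interpret H: group "G\<lparr>carrier := H\<rparr>" by (rule subgroup_imp_group[OF H])
  interpret N: normal N G by (rule N)
  have HG: "H \<subseteq> carrier G" using H subgroup.subset by blast
  have eqD: "\<exists>n\<in>N. s = n \<otimes> t" if "N #> s = N #> t" "s \<in> carrier G" for s t
    using that rcos_self[OF that(2) N.subgroup_axioms] by (auto simp: r_coset_def)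
  have "\<Gamma> (linf_functional (G\<lparr>carrier := H\<rparr>) F) = 0"
  proof (rule H.invariant_difference_finite_image[OF Gam, where q = "\<lambda>s. N #> s"])
    have "(\<lambda>s. N #> s) ` H \<subseteq> rcosets N" using HG by (auto simp: RCOSETS_def)
    then show "finite ((\<lambda>s. N #> s) ` carrier (G\<lparr>carrier := H\<rparr>))"
      using fin finite_subset by auto
  next
    fix s t h assume "s \<in> carrier (G\<lparr>carrier := H\<rparr>)" "t \<in> carrier (G\<lparr>carrier := H\<rparr>)"
      "h \<in> carrier (G\<lparr>carrier := H\<rparr>)" and eq: "N #> s = N #> t"
    then have c: "s \<in> carrier G" "t \<in> carrier G" "h \<in> carrier G" using HG by auto
    obtain n where n: "n \<in> N" "s = n \<otimes> t" using eqD[OF eq c(1)] by blast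
    then have nG: "n \<in> carrier G" using N.subset by blast
    have "h \<otimes> s = (h \<otimes> n \<otimes> inv h) \<otimes> (h \<otimes> t)"
      using c nG n by (simp add: m_assoc flip: m_assoc[of "inv h" h])
    then have "h \<otimes> s \<in> N #> (h \<otimes> t)"
      using N.inv_op_closed2[OF c(3) n(1)] by (auto simp: r_coset_def)
    then have "N #> (h \<otimes> s) = N #> (h \<otimes> t)"
      using repr_independence[of "h \<otimes> s" N "h \<otimes> t"] c N.subgroup_axioms by simp
    then show "N #> (h \<otimes>\<^bsub>G\<lparr>carrier := H\<rparr>\<^esub> s) = N #> (h \<otimes>\<^bsub>G\<lparr>carrier := H\<rparr>\<^esub> t)" by simp
  next
    fix s t assume "s \<in> carrier (G\<lparr>carrier := H\<rparr>)" "t \<in> carrier (G\<lparr>carrier := H\<rparr>)" "N #> s = N #> t"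
    then show "F s = F t" using eqD[of s t] inv[of _ t] HG by auto
  qed
  then show ?thesis using bidual_inclusion_linf[OF H F] by simp
qed

text \<open>The premise on \<open>\<Delta>\<close> is invariance under right multiplication by
  \<open>N\<close>. Normality converts it into left \<open>N\<close>-invariance of the function
  \<open>F\<close> obtained by applying \<open>\<Psi> \<box> \<Delta>\<close> to the translates of
  \<open>h\<close>. The invariant difference \<open>\<Gamma>\<close> kills every translate of
  \<open>F\<close>, so \<open>\<Phi>\<close> is applied to the zero function.\<close>

lemma arens_sandwich_zero:
  assumes N: "N \<lhd> G" and fin: "finite (rcosets N)"
    and H: "subgroup H G" and Gam: "\<Gamma> \<in> invariant_differences (G\<lparr>carrier := H\<rparr>)"
    and Phi: "\<Phi> \<in> ell1_bidual G" and Psi: "\<Psi> \<in> ell1_bidual G" and Del: "\<Delta> \<in> ell1_bidual G"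
    and inv: "\<And>n t h. n \<in> N \<Longrightarrow> t \<in> carrier G \<Longrightarrow> bounded (h ` carrier G) \<Longrightarrow>
      \<Delta> (linf_functional G (\<lambda>v. h (t \<otimes> n \<otimes> v))) = \<Delta> (linf_functional G (\<lambda>v. h (t \<otimes> v)))"
  shows "arens G (arens G \<Phi> (bidual_inclusion G H \<Gamma>)) (arens G \<Psi> \<Delta>) = 0"
proof -
  interpret N: normal N G by (rule N)
  have Hg: "group (G\<lparr>carrier := H\<rparr>)" by (rule subgroup_imp_group[OF H])
  let ?\<Gamma> = "bidual_inclusion G H \<Gamma>" and ?\<Psi> = "arens G \<Psi> \<Delta>"
  have Gb: "?\<Gamma> \<in> ell1_bidual G"
    by (rule bidual_inclusion_bidual[OF H group.invariant_difference_linf(1)[OF Hg Gam]])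
  have Pb: "?\<Psi> \<in> ell1_bidual G" by (rule arens_bidual[OF Psi Del])
  have zero: "(0 :: 'a bidual_elt) \<in> ell1_bidual G"
    by (rule bidualI[where L = "\<lambda>_. 0" and C = 0]) auto
  show ?thesis
  proof (rule bidual_eqI[OF arens_bidual[OF arens_bidual[OF Phi Gb] Pb] zero])
    fix h :: "'a \<Rightarrow> complex" assume h: "bounded (h ` carrier G)"
    define F where "F t = ?\<Psi> (linf_functional G (\<lambda>u. h (t \<otimes> u)))" for t
    have F: "bounded (F ` carrier G)" unfolding F_def by (rule bidual_translates_bounded[OF Pb h])
    have Finv: "F (n \<otimes> t) = F t" if n: "n \<in> N" and t: "t \<in> carrier G" for n t
    proof -
      have nG: "n \<in> carrier G" using n N.subset by blast
      have "\<Delta> (linf_functional G (\<lambda>v. h (n \<otimes> t \<otimes> (u \<otimes> v)))) = \<Delta> (linf_functional G (\<lambda>v. h (t \<otimes> (u \<otimes> v))))"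
        if u: "u \<in> carrier G" for u
      proof -
        \<comment> \<open>\<open>n\<close> is moved to the right past \<open>t \<otimes> u\<close>,
          where it becomes the conjugate \<open>?k\<close>, still in \<open>N\<close>; there the
          premise on \<open>\<Delta>\<close> absorbs it.\<close>
        let ?w = "t \<otimes> u" and ?k = "inv (t \<otimes> u) \<otimes> n \<otimes> (t \<otimes> u)"
        have w: "?w \<in> carrier G" and k: "?k \<in> N" using t u n N.inv_op_closed1 by auto
        have wk: "?w \<otimes> ?k = n \<otimes> ?w" using w nG by (simp add: m_assoc[symmetric] del: inv_mult_group)
        have e: "?w \<otimes> ?k \<otimes> v = n \<otimes> t \<otimes> (u \<otimes> v)" if "v \<in> carrier G" for v
          unfolding wk using that t u nG by (simp add: m_assoc)
        have "\<Delta> (linf_functional G (\<lambda>v. h (n \<otimes> t \<otimes> (u \<otimes> v)))) = \<Delta> (linf_functional G (\<lambda>v. h (?w \<otimes> ?k \<otimes> v)))"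
          by (intro arg_cong[where f = \<Delta>] linf_cong) (simp only: e)
        also have "\<dots> = \<Delta> (linf_functional G (\<lambda>v. h (?w \<otimes> v)))" by (rule inv[OF k w h])
        also have "\<dots> = \<Delta> (linf_functional G (\<lambda>v. h (t \<otimes> (u \<otimes> v))))"
          by (intro arg_cong[where f = \<Delta>] linf_cong) (simp add: m_assoc t u)
        finally show ?thesis .
      qed
      then show ?thesis
        unfolding F_def using t nG
        by (simp add: arens_linf[OF Del] bounded_translate[OF h] cong: linf_cong)
    qed
    have "?\<Gamma> (linf_functional G (\<lambda>u. F (s \<otimes> u))) = 0" if s: "s \<in> carrier G" for s
    proof (rule invariant_difference_coset_function[OF N fin H Gam bounded_translate[OF F s]])
      fix n t assume n: "n \<in> N" and t: "t \<in> carrier G"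
      then have nG: "n \<in> carrier G" using N.subset by blast
      \<comment> \<open>In the opposite direction, \<open>n\<close> is moved to the left past
        \<open>s\<close>, so that \<open>Finv\<close> can remove its conjugate.\<close>
      have "s \<otimes> (n \<otimes> t) = (s \<otimes> n \<otimes> inv s) \<otimes> (s \<otimes> t)"
        using s t nG by (simp add: m_assoc flip: m_assoc[of "inv s" s])
      then show "F (s \<otimes> (n \<otimes> t)) = F (s \<otimes> t)"
        using Finv[of "s \<otimes> n \<otimes> inv s" "s \<otimes> t"] N.inv_op_closed2[OF s n] s t by simp
    qed
    then have "arens G \<Phi> ?\<Gamma> (linf_functional G F) = \<Phi> (linf_functional G (\<lambda>_. 0))"
      by (simp add: arens_linf[OF Gb F] cong: linf_cong)
    then show "arens G (arens G \<Phi> ?\<Gamma>) ?\<Psi> (linf_functional G h) = 0 (linf_functional G h)"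
      using arens_linf[OF Pb h] bidual_zero_fun[OF Phi] unfolding F_def by simp
  qed
qed

section \<open>Bilinearity of the Arens product\<close>

lemma bidual_subspace: "cfun.subspace (ell1_bidual G)"
proof (rule cfun.subspaceI)
  show "0 \<in> ell1_bidual G" by (rule bidualI[where L = "\<lambda>_. 0" and C = 0]) auto
next
  fix \<Phi> \<Psi> assume P: "\<Phi> \<in> ell1_bidual G" and Q: "\<Psi> \<in> ell1_bidual G"
  obtain C where C: "0 \<le> C" "\<And>h B. (\<And>t. t \<in> carrier G \<Longrightarrow> norm (h t) \<le> B) \<Longrightarrow> 0 \<le> B
     \<Longrightarrow> norm (\<Phi> (linf_functional G h)) \<le> C * B"
    by (rule bidual_bound[OF P]) blast
  obtain D where D: "0 \<le> D" "\<And>h B. (\<And>t. t \<in> carrier G \<Longrightarrow> norm (h t) \<le> B) \<Longrightarrow> 0 \<le> B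
     \<Longrightarrow> norm (\<Psi> (linf_functional G h)) \<le> D * B"
    by (rule bidual_bound[OF Q]) blast
  show "\<Phi> + \<Psi> \<in> ell1_bidual G"
  proof (rule bidualI[where L = "\<lambda>h. \<Phi> (linf_functional G h) + \<Psi> (linf_functional G h)" and C = "C + D"])
    fix h :: "'a \<Rightarrow> complex" and B :: real
    assume h: "\<And>t. t \<in> carrier G \<Longrightarrow> norm (h t) \<le> B" and B: "0 \<le> B"
    show "norm (\<Phi> (linf_functional G h) + \<Psi> (linf_functional G h)) \<le> (C + D) * B"
      using norm_triangle_le[OF add_mono[OF C(2)[OF h B] D(2)[OF h B]]] by (simp add: distrib_right)
  next
    fix h k :: "'a \<Rightarrow> complex" assume hk: "\<And>t. t \<in> carrier G \<Longrightarrow> h t = k t"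
    show "\<Phi> (linf_functional G h) + \<Psi> (linf_functional G h) = \<Phi> (linf_functional G k) + \<Psi> (linf_functional G k)"
      by (simp only: linf_cong[of G h k, OF hk])
  qed (auto simp: bidual_add P Q bidual_scale distrib_left bidual_outside[OF P] bidual_outside[OF Q])
next
  fix c \<Phi> assume P: "\<Phi> \<in> ell1_bidual G"
  obtain C where C: "0 \<le> C" "\<And>h B. (\<And>t. t \<in> carrier G \<Longrightarrow> norm (h t) \<le> B) \<Longrightarrow> 0 \<le> B
     \<Longrightarrow> norm (\<Phi> (linf_functional G h)) \<le> C * B"
    by (rule bidual_bound[OF P]) blast
  show "fscale c \<Phi> \<in> ell1_bidual G"
  proof (rule bidualI[where L = "\<lambda>h. c * \<Phi> (linf_functional G h)" and C = "norm c * C"])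
    fix h :: "'a \<Rightarrow> complex" and B :: real
    assume h: "\<And>t. t \<in> carrier G \<Longrightarrow> norm (h t) \<le> B" and B: "0 \<le> B"
    show "norm (c * \<Phi> (linf_functional G h)) \<le> norm c * C * B"
      using mult_left_mono[OF C(2)[OF h B] norm_ge_zero[of c]] by (simp add: norm_mult mult.assoc)
  next
    fix h k :: "'a \<Rightarrow> complex" assume hk: "\<And>t. t \<in> carrier G \<Longrightarrow> h t = k t"
    show "c * \<Phi> (linf_functional G h) = c * \<Phi> (linf_functional G k)"
      by (simp only: linf_cong[of G h k, OF hk])
  qed (auto simp: bidual_add P bidual_scale distrib_left bidual_outside[OF P] fscale_def)
qed

lemma arens_add_left: "arens G (\<Phi> + \<Phi>') \<Psi> = arens G \<Phi> \<Psi> + arens G \<Phi>' \<Psi>"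
  by (auto simp: arens_def arens_product_def)

lemma arens_scale_left: "arens G (fscale c \<Phi>) \<Psi> = fscale c (arens G \<Phi> \<Psi>)"
  by (auto simp: arens_def arens_product_def fscale_def)

lemma arens_zero_left: "arens G 0 \<Psi> = 0"
  by (auto simp: arens_def arens_product_def)

text \<open>On the left, additivity is pointwise in the definition. On the right it passes through
  the inner functional, so it is tested on bounded functions with \<open>arens_linf\<close>.\<close>

lemma arens_add_right:
  assumes P: "\<Phi> \<in> ell1_bidual G" and Q: "\<Psi> \<in> ell1_bidual G" "\<Psi>' \<in> ell1_bidual G"
  shows "arens G \<Phi> (\<Psi> + \<Psi>') = arens G \<Phi> \<Psi> + arens G \<Phi> \<Psi>'"
proof (rule bidual_eqI)
  show "arens G \<Phi> (\<Psi> + \<Psi>') \<in> ell1_bidual G" "arens G \<Phi> \<Psi> + arens G \<Phi> \<Psi>' \<in> ell1_bidual G"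
    using assms by (auto intro: arens_bidual cfun.subspace_add[OF bidual_subspace])
  fix h :: "'a \<Rightarrow> complex" assume "bounded (h ` carrier G)"
  then show "arens G \<Phi> (\<Psi> + \<Psi>') (linf_functional G h) = (arens G \<Phi> \<Psi> + arens G \<Phi> \<Psi>') (linf_functional G h)"
    using Q bidual_add[OF P bidual_translates_bounded[OF Q(1)] bidual_translates_bounded[OF Q(2)]]
    by (simp add: arens_linf cfun.subspace_add[OF bidual_subspace])
qed

lemma arens_scale_right:
  assumes P: "\<Phi> \<in> ell1_bidual G" and Q: "\<Psi> \<in> ell1_bidual G"
  shows "arens G \<Phi> (fscale c \<Psi>) = fscale c (arens G \<Phi> \<Psi>)"
proof (rule bidual_eqI)
  show "arens G \<Phi> (fscale c \<Psi>) \<in> ell1_bidual G" "fscale c (arens G \<Phi> \<Psi>) \<in> ell1_bidual G"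
    using assms by (auto intro: arens_bidual cfun.subspace_scale[OF bidual_subspace])
  fix h :: "'a \<Rightarrow> complex" assume "bounded (h ` carrier G)"
  then show "arens G \<Phi> (fscale c \<Psi>) (linf_functional G h) = fscale c (arens G \<Phi> \<Psi>) (linf_functional G h)"
    using bidual_scale[OF P bidual_translates_bounded[OF Q], of h c] cfun.subspace_scale[OF bidual_subspace Q, of c]
    by (simp add: arens_linf[OF Q] arens_linf[of "fscale c \<Psi>"] fscale_def[of c "arens G \<Phi> \<Psi>"]) (simp add: fscale_def)
qed

lemma arens_zero_right:
  assumes "\<Phi> \<in> ell1_bidual G"
  shows "arens G \<Phi> 0 = 0"
  using arens_scale_right[OF assms cfun.subspace_0[OF bidual_subspace], of 0]
  by (simp only: cfun.scale_zero_left)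

lemma square_zero_span:
  assumes S: "S \<subseteq> ell1_bidual G" and zero: "\<And>\<Phi> \<Psi>. \<Phi> \<in> S \<Longrightarrow> \<Psi> \<in> S \<Longrightarrow> arens G \<Phi> \<Psi> = 0"
  shows "square_zero G (cfun.span S)"
proof -
  have "arens G \<Phi> \<Psi> = 0" if "\<Phi> \<in> cfun.span S" "\<Psi> \<in> S" for \<Phi> \<Psi>
    using that(1)
  proof (induction rule: cfun.span_induct)
    show "cfun.subspace {\<Phi>. arens G \<Phi> \<Psi> = 0}"
      by (auto simp: cfun.subspace_def arens_zero_left arens_add_left arens_scale_left)
  qed (use zero that in auto)
  note left = this
  have span: "cfun.span S \<subseteq> ell1_bidual G" by (rule cfun.span_minimal[OF S bidual_subspace])
  \<comment> \<open>Membership in the bidual travels along the induction, because linearity on the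
    right is available for bidual elements.\<close>
  have "arens G \<Phi> \<Psi> = 0 \<and> \<Psi> \<in> ell1_bidual G" if P: "\<Phi> \<in> cfun.span S" and "\<Psi> \<in> cfun.span S" for \<Phi> \<Psi>
    using that(2)
  proof (induction rule: cfun.span_induct)
    have "\<Phi> \<in> ell1_bidual G" using P span by blast
    then show "cfun.subspace {\<Psi>. arens G \<Phi> \<Psi> = 0 \<and> \<Psi> \<in> ell1_bidual G}"
      using bidual_subspace
      by (auto simp: cfun.subspace_def arens_zero_right arens_add_right arens_scale_right)
  qed (use left P S in auto)
  then show ?thesis by (auto simp: square_zero_def)
qed

section \<open>Square zero for \<open>J_sn\<close> and the inclusion of \<open>A_sn\<close>\<close>

text \<open>The dichotomy is applied to the subgroup \<open>K\<close> of the right factor only. If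
  \<open>K\<close> is finite that factor is zero; otherwise invariance under \<open>K\<close>, hence
  under \<open>N\<close>, feeds \<open>arens_sandwich_zero\<close>, whatever the subgroup of the
  left factor.\<close>

lemma J_sn_square_zero:
  assumes sn: "\<And>K. subnormal K G \<Longrightarrow> finite K \<or> (\<exists>N. N \<lhd> G \<and> finite (rcosets N) \<and> N \<subseteq> K)"
  shows "square_zero G (J_sn G)"
  unfolding J_sn_def
proof (rule square_zero_span)
  show "{arens G \<Phi> \<Gamma> |\<Phi> \<Gamma>. \<Phi> \<in> ell1_bidual G \<and> \<Gamma> \<in> D_sn G} \<subseteq> ell1_bidual G"
    by (auto intro!: arens_bidual elim: D_snE)
next
  fix A B
  assume "A \<in> {arens G \<Phi> \<Gamma> |\<Phi> \<Gamma>. \<Phi> \<in> ell1_bidual G \<and> \<Gamma> \<in> D_sn G}"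
    and "B \<in> {arens G \<Phi> \<Gamma> |\<Phi> \<Gamma>. \<Phi> \<in> ell1_bidual G \<and> \<Gamma> \<in> D_sn G}"
  then obtain \<Phi> \<Gamma> \<Psi> \<Delta> where A: "A = arens G \<Phi> \<Gamma>" "\<Phi> \<in> ell1_bidual G" "\<Gamma> \<in> D_sn G"
    and B: "B = arens G \<Psi> \<Delta>" "\<Psi> \<in> ell1_bidual G" "\<Delta> \<in> D_sn G" by auto
  obtain H \<Gamma>' where H: "subgroup H G" "\<Gamma>' \<in> invariant_differences (G\<lparr>carrier := H\<rparr>)"
    "\<Gamma> = bidual_inclusion G H \<Gamma>'"
    using A(3) by (rule D_snE)
  obtain K \<Delta>' where K: "subnormal K G" "subgroup K G" "group (G\<lparr>carrier := K\<rparr>)"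
    "\<Delta>' \<in> invariant_differences (G\<lparr>carrier := K\<rparr>)" "\<Delta> = bidual_inclusion G K \<Delta>'" "\<Delta> \<in> ell1_bidual G"
    using B(3) by (rule D_snE)
  show "arens G A B = 0"
    using sn[OF K(1)]
  proof
    assume "finite K"
    then have "\<Delta>' = 0" using group.invariant_difference_finite_group[OF K(3) _ K(4)] by simp
    then have "\<Delta> = 0" using K(5) by (auto simp: bidual_inclusion_def adjoint_map_def fun_eq_iff)
    moreover have "arens G \<Phi> \<Gamma> \<in> ell1_bidual G" using A by (auto intro!: arens_bidual elim: D_snE)
    ultimately show ?thesis by (simp add: A B arens_zero_right)
  next
    assume "\<exists>N. N \<lhd> G \<and> finite (rcosets N) \<and> N \<subseteq> K"
    then obtain N where N: "N \<lhd> G" "finite (rcosets N)" "N \<subseteq> K" by blast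
    show ?thesis
      unfolding A(1) B(1) H(3)
      by (rule arens_sandwich_zero[OF N(1,2) H(1,2) A(2) B(2) K(6)])
        (use N(3) K(4) D_sn_coset_invariant[OF K(2)] in \<open>auto simp: K(5)\<close>)
  qed
qed

lemma foldl_arens_bidual:
  assumes "\<Gamma> \<in> D_sn G" "set \<Gamma>s \<subseteq> D_sn G"
  shows "foldl (arens G) \<Gamma> \<Gamma>s \<in> ell1_bidual G"
  using assms(2)
proof (induction \<Gamma>s rule: rev_induct)
  case Nil
  then show ?case using assms(1) by (auto elim: D_snE)
next
  case (snoc \<Delta> \<Gamma>s)
  then show ?case by (auto intro!: arens_bidual elim: D_snE)
qed

lemma arens_delta_one:
  assumes "\<Gamma> \<in> ell1_bidual G"
  shows "arens G (delta G \<one>) \<Gamma> = \<Gamma>"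
  by (rule bidual_eqI[where G = G])
    (auto simp: assms arens_bidual delta_bidual arens_delta cong: linf_cong)

text \<open>All factors but the last are collected into \<open>\<Phi>\<close>; a single factor
  receives \<open>delta G \<one>\<close> in front.\<close>

lemma A_sn_subset_J_sn: "A_sn G \<subseteq> J_sn G"
  unfolding A_sn_def J_sn_def
proof (rule cfun.span_mono, rule subsetI)
  fix A assume "A \<in> {foldl (arens G) \<Gamma> \<Gamma>s |\<Gamma> \<Gamma>s. \<Gamma> \<in> D_sn G \<and> set \<Gamma>s \<subseteq> D_sn G}"
  then obtain \<Gamma> \<Gamma>s where A: "A = foldl (arens G) \<Gamma> \<Gamma>s" "\<Gamma> \<in> D_sn G" "set \<Gamma>s \<subseteq> D_sn G" by auto
  show "A \<in> {arens G \<Phi> \<Gamma> |\<Phi> \<Gamma>. \<Phi> \<in> ell1_bidual G \<and> \<Gamma> \<in> D_sn G}"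
  proof (cases \<Gamma>s rule: rev_cases)
    case Nil
    then have "A = arens G (delta G \<one>) \<Gamma>"
      using A arens_delta_one by (auto elim: D_snE)
    then show ?thesis using A(2) delta_bidual by blast
  next
    case (snoc \<Delta>s \<Delta>)
    then show ?thesis using A foldl_arens_bidual[OF A(2), of \<Delta>s] by auto
  qed
qed

section \<open>Nonzero invariant differences on infinite subgroups\<close>

text \<open>Choose a representative of each coset \<open>H #> t\<close> and let
  \<open>\<beta> t\<close> be the \<open>H\<close>-component of \<open>t\<close> relative to it.
  Composition with \<open>\<beta>\<close> turns functions on \<open>H\<close> into functions on the
  group, compatibly with left translation by \<open>H\<close>.\<close>

lemma left_equivariant_map:
  assumes H: "subgroup H G"
  obtains \<beta> where "\<And>t. t \<in> carrier G \<Longrightarrow> \<beta> t \<in> H"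
    "\<And>h t. h \<in> H \<Longrightarrow> t \<in> carrier G \<Longrightarrow> \<beta> (h \<otimes> t) = h \<otimes> \<beta> t"
proof -
  define r where "r C = (SOME x. x \<in> C)" for C :: "'a set"
  define \<beta> where "\<beta> t = t \<otimes> inv (r (H #> t))" for t
  have HG: "H \<subseteq> carrier G" using H subgroup.subset by blast
  have r: "r (H #> t) \<in> H #> t" if "t \<in> carrier G" for t
    unfolding r_def by (rule someI[of _ t]) (rule rcos_self[OF that H])
  have rG: "r (H #> t) \<in> carrier G" if "t \<in> carrier G" for t
    using r[OF that] r_coset_subset_G[OF HG that] by blast
  show thesis
  proof
    fix t assume t: "t \<in> carrier G"
    obtain h where h: "h \<in> H" "r (H #> t) = h \<otimes> t" using r[OF t] by (auto simp: r_coset_def)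
    have "\<beta> t = inv h" unfolding \<beta>_def h(2) using h(1) t HG
      by (simp add: subset_iff inv_mult_group m_assoc[symmetric])
    then show "\<beta> t \<in> H" using h(1) subgroup.m_inv_closed[OF H] by simp
  next
    fix h t assume h: "h \<in> H" and t: "t \<in> carrier G"
    have "H #> (h \<otimes> t) = H #> t"
      using h t HG H by (metis coset_mult_assoc subgroup.rcos_const is_group subset_iff)
    then show "\<beta> (h \<otimes> t) = h \<otimes> \<beta> t"
      unfolding \<beta>_def using h t HG rG[OF t] by (simp add: m_assoc subset_iff)
  qed
qed

lemma right_equivariant_map:
  assumes H: "subgroup H G"
  obtains \<gamma> where "\<And>t. t \<in> carrier G \<Longrightarrow> \<gamma> t \<in> H"
    "\<And>h t. h \<in> H \<Longrightarrow> t \<in> carrier G \<Longrightarrow> \<gamma> (t \<otimes> h) = \<gamma> t \<otimes> h"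
proof -
  obtain \<beta> where b: "\<And>t. t \<in> carrier G \<Longrightarrow> \<beta> t \<in> H"
    "\<And>h t. h \<in> H \<Longrightarrow> t \<in> carrier G \<Longrightarrow> \<beta> (h \<otimes> t) = h \<otimes> \<beta> t"
    using left_equivariant_map[OF H] by blast
  have HG: "H \<subseteq> carrier G" using H subgroup.subset by blast
  show thesis
  proof (rule that[of "\<lambda>t. inv (\<beta> (inv t))"])
    show "inv (\<beta> (inv t)) \<in> H" if "t \<in> carrier G" for t
      using that b(1) subgroup.m_inv_closed[OF H] by simp
    fix h t assume h: "h \<in> H" and t: "t \<in> carrier G"
    have "\<beta> (inv (t \<otimes> h)) = inv h \<otimes> \<beta> (inv t)"
      using b(2)[of "inv h" "inv t"] subgroup.m_inv_closed[OF H h] h t HG by (auto simp: inv_mult_group)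
    then show "inv (\<beta> (inv (t \<otimes> h))) = inv (\<beta> (inv t)) \<otimes> h"
      using h t HG b(1)[of "inv t"] by (auto simp: inv_mult_group subset_iff)
  qed
qed

section \<open>Countable subgroups and a separating function\<close>

text \<open>Every element is the product of a finite word in the generators and their inverses, and
  a countable alphabet has countably many words.\<close>

lemma countable_generate:
  assumes S: "S \<subseteq> carrier G" and "countable S"
  shows "countable (generate G S)"
proof -
  let ?T = "S \<union> m_inv G ` S" and ?p = "\<lambda>l. foldr (\<otimes>) l \<one>"
  have T: "?T \<subseteq> carrier G" using S by auto
  have closed: "?p l \<in> carrier G" if "l \<in> lists ?T" for l
    using that T by (induction l) auto
  have app: "?p (k @ l) = ?p k \<otimes> ?p l" if "k \<in> lists ?T" "l \<in> lists ?T" for k l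
    using that(1)
  proof (induction k)
    case Nil
    then show ?case using closed[OF that(2)] by simp
  next
    case (Cons a k)
    then show ?case using closed[of k] closed[OF that(2)] T by (auto simp: m_assoc)
  qed
  have "x \<in> ?p ` lists ?T" if "x \<in> generate G S" for x
    using that
  proof (induction rule: generate.induct)
    case one
    then show ?case by (rule image_eqI[of _ _ "[]"]) auto
  next
    case (incl h)
    then show ?case using S by (intro image_eqI[of _ _ "[h]"]) auto
  next
    case (inv h)
    then show ?case using S by (intro image_eqI[of _ _ "[inv h]"]) auto
  next
    case (eng h1 h2)
    then obtain k l where kl: "k \<in> lists ?T" "l \<in> lists ?T" "h1 = ?p k" "h2 = ?p l" by auto
    show ?case by (rule image_eqI[of _ _ "k @ l"]) (use kl app in auto)
  qed
  moreover have "countable (?p ` lists ?T)" using \<open>countable S\<close> by (intro countable_image countable_lists) auto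
  ultimately show ?thesis by (meson countable_subset subsetI)
qed

lemma countable_infinite_subgroup:
  assumes "infinite (carrier G)"
  obtains H and e :: "nat \<Rightarrow> 'a" where "subgroup H G" "bij_betw e UNIV H"
proof -
  obtain S where S: "S \<subseteq> carrier G" "countable S" "infinite S"
    using infinite_countable_subset'[OF assms] by blast
  have "infinite (generate G S)" using S(3) generate.incl[of _ S G] by (meson finite_subset subsetI)
  then show thesis
    using that bij_betw_from_nat_into[OF countable_generate[OF S(1,2)]] generate_is_subgroup[OF S(1)] by blast
qed

text \<open>The blocks \<open>{e i \<otimes> x n | i \<le> n}\<close> are made pairwise disjoint by
  choosing \<open>x n\<close> inductively: each stage excludes finitely many elements of the
  infinite \<open>H\<close>.\<close>

lemma translate_avoiding_sequence:
  fixes e :: "nat \<Rightarrow> 'a"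
  assumes H: "subgroup H G" and e: "bij_betw e UNIV H"
  obtains x :: "nat \<Rightarrow> 'a" where "\<And>n. x n \<in> H"
    "\<And>n m i j. m \<noteq> n \<Longrightarrow> i \<le> n \<Longrightarrow> j \<le> m \<Longrightarrow> e i \<otimes> x n \<noteq> e j \<otimes> x m"
proof -
  have HG: "H \<subseteq> carrier G" using H subgroup.subset by blast
  have eH: "e i \<in> H" for i using e by (auto simp: bij_betw_def)
  have inf: "infinite H" using e bij_betw_finite infinite_UNIV_nat by blast
  have "\<exists>x. \<forall>n. x n \<in> H \<and> (\<forall>m<n. \<forall>i\<le>n. \<forall>j\<le>m. e i \<otimes> x n \<noteq> e j \<otimes> x m)"
  proof (rule dependent_wellorder_choice)
    fix n and x :: "nat \<Rightarrow> 'a"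
    assume "\<And>m. m < n \<Longrightarrow> x m \<in> H \<and> (\<forall>k<m. \<forall>i\<le>m. \<forall>j\<le>k. e i \<otimes> x m \<noteq> e j \<otimes> x k)"
    then have x: "x m \<in> carrier G" if "m < n" for m using HG that by blast
    \<comment> \<open>\<open>?X\<close> contains every solution \<open>r\<close> of an equation
      \<open>e i \<otimes> r = e j \<otimes> x m\<close> that has to be avoided.\<close>
    let ?X = "(\<lambda>(i, j, m). inv (e i) \<otimes> (e j \<otimes> x m)) ` ({..n} \<times> {..n} \<times> {..<n})"
    have "finite ?X" by auto
    then have "infinite (H - ?X)" by (rule Diff_infinite_finite[OF _ inf])
    then have "H - ?X \<noteq> {}" by (metis finite.emptyI)
    then obtain r where r: "r \<in> H" "r \<notin> ?X" by blast
    have "e i \<otimes> r \<noteq> e j \<otimes> x m" if "m < n" "i \<le> n" "j \<le> m" for i j m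
    proof
      assume eq: "e i \<otimes> r = e j \<otimes> x m"
      have c: "e i \<in> carrier G" "r \<in> carrier G" using eH r HG by auto
      have "r = inv (e i) \<otimes> (e i \<otimes> r)" using c by (simp add: m_assoc[symmetric])
      then have "r = inv (e i) \<otimes> (e j \<otimes> x m)" by (simp only: eq)
      then have "r \<in> ?X" using that by (intro image_eqI[of _ _ "(i, j, m)"]) auto
      then show False using r by simp
    qed
    then show "\<exists>r. r \<in> H \<and> (\<forall>m<n. \<forall>i\<le>n. \<forall>j\<le>m. e i \<otimes> r \<noteq> e j \<otimes> x m)" using r by blast
  qed simp
  then obtain x where x: "\<And>n. x n \<in> H" "\<And>n m i j. m < n \<Longrightarrow> i \<le> n \<Longrightarrow> j \<le> m \<Longrightarrow> e i \<otimes> x n \<noteq> e j \<otimes> x m"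
    by blast
  show thesis
  proof (rule that[of x])
    show "e i \<otimes> x n \<noteq> e j \<otimes> x m" if "m \<noteq> n" "i \<le> n" "j \<le> m" for n m i j
      using x(2)[of m n i j] x(2)[of n m j i] that by (metis linorder_neqE_nat)
  qed (rule x(1))
qed

text \<open>\<open>T\<close> is built from initial parts of the even-numbered disjoint blocks. If
  \<open>\<gamma> t = e k\<close>, right multiplication by \<open>x (2 * n)\<close> leads into
  \<open>T\<close> once \<open>k \<le> n\<close>, while \<open>x (2 * n + 1)\<close> leads into an
  odd block, away from \<open>T\<close>. Right equivariance of \<open>\<gamma>\<close> extends this
  from the countable subgroup \<open>H\<close> to the whole group.\<close>

lemma separating_function:
  assumes "infinite (carrier G)"
  obtains f :: "'a \<Rightarrow> complex" and g g' :: "nat \<Rightarrow> 'a" where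
    "\<And>t. norm (f t) \<le> 1" "\<And>n. g n \<in> carrier G" "\<And>n. g' n \<in> carrier G"
    "\<And>t. t \<in> carrier G \<Longrightarrow> \<exists>N. \<forall>n\<ge>N. f (t \<otimes> g n) = 1 \<and> f (t \<otimes> g' n) = 0"
proof -
  obtain H and e :: "nat \<Rightarrow> 'a" where H: "subgroup H G" and e: "bij_betw e UNIV H"
    by (rule countable_infinite_subgroup[OF assms])
  obtain x :: "nat \<Rightarrow> 'a" where xH: "\<And>n. x n \<in> H" and
    x: "\<And>n m i j. m \<noteq> n \<Longrightarrow> i \<le> n \<Longrightarrow> j \<le> m \<Longrightarrow> e i \<otimes> x n \<noteq> e j \<otimes> x m"
    by (rule translate_avoiding_sequence[OF H e]) blast
  obtain \<gamma> where g: "\<And>t. t \<in> carrier G \<Longrightarrow> \<gamma> t \<in> H"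
    "\<And>h t. h \<in> H \<Longrightarrow> t \<in> carrier G \<Longrightarrow> \<gamma> (t \<otimes> h) = \<gamma> t \<otimes> h"
    by (rule right_equivariant_map[OF H]) blast
  have HG: "H \<subseteq> carrier G" using H subgroup.subset by blast
  define T where "T = {e i \<otimes> x (2 * n) |i n. i \<le> n}"
  define f where "f t = (if \<gamma> t \<in> T then 1 else 0 :: complex)" for t
  show thesis
  proof (rule that[of f "\<lambda>n. x (2 * n)" "\<lambda>n. x (2 * n + 1)"])
    fix t assume t: "t \<in> carrier G"
    obtain k where k: "\<gamma> t = e k" using g(1)[OF t] e by (metis bij_betw_imp_surj_on imageE)
    have "f (t \<otimes> x (2 * n)) = 1 \<and> f (t \<otimes> x (2 * n + 1)) = 0" if n: "n \<ge> k" for n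
    proof
      have "\<gamma> (t \<otimes> x (2 * n)) \<in> T" unfolding g(2)[OF xH t] k T_def using n by blast
      then show "f (t \<otimes> x (2 * n)) = 1" by (simp add: f_def)
      have "e k \<otimes> x (2 * n + 1) \<noteq> e i \<otimes> x (2 * m)" if "i \<le> m" for i m
      proof (rule x)
        show "2 * m \<noteq> 2 * n + 1" by presburger
      qed (use n that in auto)
      then have "\<gamma> (t \<otimes> x (2 * n + 1)) \<notin> T" unfolding g(2)[OF xH t] k T_def by blast
      then show "f (t \<otimes> x (2 * n + 1)) = 0" by (simp add: f_def)
    qed
    then show "\<exists>N. \<forall>n\<ge>N. f (t \<otimes> x (2 * n)) = 1 \<and> f (t \<otimes> x (2 * n + 1)) = 0" by blast
  qed (use xH HG in \<open>auto simp: f_def\<close>)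
qed

section \<open>Invariant differences from an invariant mean\<close>

text \<open>\<open>\<nu> u\<close> is the position of \<open>\<beta> u\<close> in the enumeration of
  \<open>H\<close>. Its fibres are left translates of one another and so share one mean
  \<open>\<mu>\<close>; since \<open>k\<close> of them together have mean \<open>k * \<mu>\<close>,
  bounded independently of \<open>k\<close>, this forces \<open>\<mu> = 0\<close>. Finitely many
  indices then do not affect \<open>M\<close>.\<close>

lemma mean_limit_index:
  assumes inf: "infinite (carrier G)" and M: "M \<in> ell1_bidual G" and one: "M (one_functional G) = 1"
    and inv: "\<And>s h. s \<in> carrier G \<Longrightarrow> bounded (h ` carrier G) \<Longrightarrow>
      M (linf_functional G (\<lambda>u. h (s \<otimes> u))) = M (linf_functional G h)"
  obtains \<nu> :: "'a \<Rightarrow> nat" where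
    "\<forall>c L N. (\<forall>n\<ge>N. c n = L) \<longrightarrow> M (linf_functional G (\<lambda>u. c (\<nu> u))) = L"
proof -
  obtain H and e :: "nat \<Rightarrow> 'a" where H: "subgroup H G" and e: "bij_betw e UNIV H"
    by (rule countable_infinite_subgroup[OF inf])
  obtain \<beta> where b: "\<And>t. t \<in> carrier G \<Longrightarrow> \<beta> t \<in> H"
    "\<And>h t. h \<in> H \<Longrightarrow> t \<in> carrier G \<Longrightarrow> \<beta> (h \<otimes> t) = h \<otimes> \<beta> t"
    by (rule left_equivariant_map[OF H]) blast
  have HG: "H \<subseteq> carrier G" using H subgroup.subset by blast
  have eH: "e i \<in> H" for i using e by (auto simp: bij_betw_def)
  define \<nu> where "\<nu> u = inv_into UNIV e (\<beta> u)" for u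
  have nu: "\<nu> u = n \<longleftrightarrow> \<beta> u = e n" if "u \<in> carrier G" for u n
    using e b(1)[OF that] unfolding \<nu>_def bij_betw_def by (metis f_inv_into_f inv_into_f_f UNIV_I)
  define E where "E n u = (if \<nu> u = n then 1 else 0 :: complex)" for n u
  have bE: "bounded (E n ` carrier G)" for n by (auto simp: bounded_iff E_def intro!: exI[of _ 1])
  have translate: "M (linf_functional G (E n)) = M (linf_functional G (E m))" for n m
  proof -
    let ?h = "e n \<otimes> inv (e m)"
    have c: "e n \<in> carrier G" "e m \<in> carrier G" using eH HG by auto
    have h: "?h \<in> H" using eH subgroup.m_inv_closed[OF H] subgroup.m_closed[OF H] by blast
    have "E n (?h \<otimes> u) = E m u" if u: "u \<in> carrier G" for u
    proof -
      have bu: "\<beta> u \<in> carrier G" using b(1)[OF u] HG by blast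
      have "?h \<otimes> \<beta> u = e n \<longleftrightarrow> \<beta> u = e m"
      proof
        assume "?h \<otimes> \<beta> u = e n"
        then have "e n \<otimes> (inv (e m) \<otimes> \<beta> u) = e n \<otimes> \<one>" using c bu by (simp add: m_assoc)
        then have "inv (e m) \<otimes> \<beta> u = \<one>" using c bu by (simp only: l_cancel inv_closed m_closed one_closed)
        then show "\<beta> u = e m" using c bu by (metis inv_equality inv_inv inv_closed inv_comm)
      qed (use c in \<open>simp add: m_assoc\<close>)
      then show ?thesis
        using nu[of u m] nu[of "?h \<otimes> u" n] b(2)[OF h u] u c by (simp add: E_def)
    qed
    then have "linf_functional G (\<lambda>u. E n (?h \<otimes> u)) = linf_functional G (E m)"
      by (rule linf_cong)
    then show ?thesis using inv[of ?h "E n"] bE c by simp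
  qed
  define \<mu> where "\<mu> = M (linf_functional G (E 0))"
  have mu: "M (linf_functional G (E n)) = \<mu>" for n unfolding \<mu>_def by (rule translate)
  have sum: "bounded ((\<lambda>u. \<Sum>n<k. d n * E n u) ` carrier G) \<and>
    M (linf_functional G (\<lambda>u. \<Sum>n<k. d n * E n u)) = (\<Sum>n<k. d n) * \<mu>" for k d
  proof (induction k)
    case 0
    then show ?case using bidual_zero_fun[OF M] by (simp add: bounded_const)
  next
    case (Suc k)
    have b1: "bounded ((\<lambda>u. d k * E k u) ` carrier G)" by (rule bounded_cmult[OF bE])
    have "M (linf_functional G (\<lambda>u. d k * E k u)) = d k * \<mu>"
      using bidual_scale[OF M bE] mu by simp
    then show ?case
      using Suc b1 bidual_add[OF M conjunct1[OF Suc] b1] by (simp add: distrib_right bounded_plus_comp)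
  qed
  obtain C where C: "\<And>h B. (\<And>t. t \<in> carrier G \<Longrightarrow> norm (h t) \<le> B) \<Longrightarrow> 0 \<le> B
     \<Longrightarrow> norm (M (linf_functional G h)) \<le> C * B"
    by (rule bidual_bound[OF M]) blast
  have pick: "(\<Sum>n<k. d n * E n u) = (if \<nu> u < k then d (\<nu> u) else 0)" for d k u
    by (simp add: E_def if_distrib[of "(*) _"] cong: if_cong)
  \<comment> \<open>The sum of the first \<open>k\<close> indicators is itself an indicator, so its
    mean has norm at most \<open>C\<close> for every \<open>k\<close>.\<close>
  have "real k * norm \<mu> \<le> C" for k
  proof -
    have "norm (M (linf_functional G (\<lambda>u. \<Sum>n<k. 1 * E n u))) \<le> C * 1"
      by (rule C) (simp_all only: pick, auto)
    then have "norm (of_nat k * \<mu>) \<le> C" using conjunct2[OF sum[of "\<lambda>_. 1" k]] by simp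
    then show ?thesis by (simp add: norm_mult)
  qed
  then have mu0: "\<mu> = 0"
    by (metis norm_le_zero_iff not_le reals_Archimedean3)
  show thesis
  proof (rule that[of \<nu>], intro allI impI)
    fix c :: "nat \<Rightarrow> complex" and L N
    assume c: "\<forall>n\<ge>N. c n = L"
    \<comment> \<open>\<open>?s\<close> carries the deviation of \<open>c\<close> from
      \<open>L\<close>, which is confined to the null fibres below \<open>N\<close>.\<close>
    let ?s = "\<lambda>u. \<Sum>n<N. (c n - L) * E n u"
    have "linf_functional G (\<lambda>u. c (\<nu> u)) = linf_functional G (\<lambda>u. L * 1 + ?s u)"
      by (rule linf_cong) (simp add: pick c)
    moreover have "M \<dots> = L * 1 + (\<Sum>n<N. c n - L) * \<mu>"
      using bidual_add[OF M bounded_const conjunct1[OF sum], of "L * 1"] bidual_scale[OF M bounded_const, of L 1] sum[of "\<lambda>n. c n - L" N] one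
      by simp
    ultimately show "M (linf_functional G (\<lambda>u. c (\<nu> u))) = L" using mu0 by simp
  qed
qed

text \<open>The mean of \<open>G\<close> is transported to \<open>B\<close> through
  \<open>\<beta>\<close>, so no mean on \<open>B\<close> is constructed first. Translating by
  \<open>s\<close> in \<open>B\<close> replaces \<open>t\<close> by \<open>s \<otimes> t\<close>,
  which the outer mean absorbs. Constants cancel in the difference, whereas for \<open>f\<close> the
  inner mean is 1.\<close>

lemma nonzero_invariant_difference:
  assumes B: "subgroup B G" and inf: "infinite B"
    and M: "M \<in> ell1_bidual G" and one: "M (one_functional G) = 1"
    and inv: "\<And>s h. s \<in> carrier G \<Longrightarrow> bounded (h ` carrier G) \<Longrightarrow>
      M (linf_functional G (\<lambda>u. h (s \<otimes> u))) = M (linf_functional G h)"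
  obtains \<Gamma> and f :: "'a \<Rightarrow> complex" where "\<Gamma> \<in> invariant_differences (G\<lparr>carrier := B\<rparr>)" "\<And>t. norm (f t) \<le> 1"
    "\<Gamma> (linf_functional (G\<lparr>carrier := B\<rparr>) f) = 1"
proof -
  let ?B = "G\<lparr>carrier := B\<rparr>"
  have BG: "B \<subseteq> carrier G" using B subgroup.subset by blast
  interpret B: group ?B by (rule subgroup_imp_group[OF B])
  have infG: "infinite (carrier G)" using inf BG finite_subset by blast
  obtain f :: "'a \<Rightarrow> complex" and g g' :: "nat \<Rightarrow> 'a" where f: "\<And>t. norm (f t) \<le> 1"
    and g: "\<And>n. g n \<in> carrier ?B" "\<And>n. g' n \<in> carrier ?B"
    and lim: "\<And>t. t \<in> carrier ?B \<Longrightarrow> \<exists>N. \<forall>n\<ge>N. f (t \<otimes>\<^bsub>?B\<^esub> g n) = 1 \<and> f (t \<otimes>\<^bsub>?B\<^esub> g' n) = 0"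
    by (rule B.separating_function) (use inf in auto)
  obtain \<beta> where b: "\<And>t. t \<in> carrier G \<Longrightarrow> \<beta> t \<in> B"
    "\<And>h t. h \<in> B \<Longrightarrow> t \<in> carrier G \<Longrightarrow> \<beta> (h \<otimes> t) = h \<otimes> \<beta> t"
    by (rule left_equivariant_map[OF B]) blast
  obtain \<nu> :: "'a \<Rightarrow> nat" where
    nu: "\<forall>c L N. (\<forall>n\<ge>N. c n = L) \<longrightarrow> M (linf_functional G (\<lambda>u. c (\<nu> u))) = L"
    by (rule mean_limit_index[OF infG M one inv])
  \<comment> \<open>\<open>g\<close> and \<open>g'\<close> multiply on the right, out of the way of
    left translation. \<open>I\<close> averages \<open>D\<close> over \<open>u\<close>, and
    \<open>L\<close> averages the result over \<open>t\<close>; the order matters, since the index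
    where \<open>f\<close> stabilises depends on \<open>t\<close>.\<close>
  define D where "D h t u = h (\<beta> t \<otimes> g (\<nu> u)) - (h (\<beta> t \<otimes> g' (\<nu> u)) :: complex)" for h t u
  define I where "I h t = M (linf_functional G (D h t))" for h t
  define L where "L h = M (linf_functional G (I h))" for h
  \<comment> \<open>A functional is converted to its bounded function by its values at point masses;
    0 off the dual is the required normalisation.\<close>
  define \<Gamma> where "\<Gamma> \<phi> = (if \<phi> \<in> dual (ell1 ?B) (ell1_norm ?B) then L (\<lambda>t. \<phi> (point_mass t)) else 0)" for \<phi>
  obtain C where C0: "0 \<le> C" and C: "\<And>h K. (\<And>t. t \<in> carrier G \<Longrightarrow> norm (h t) \<le> K) \<Longrightarrow> 0 \<le> K
     \<Longrightarrow> norm (M (linf_functional G h)) \<le> C * K"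
    by (rule bidual_bound[OF M]) blast
  have mem: "\<beta> t \<otimes> g n \<in> B" "\<beta> t \<otimes> g' n \<in> B" if "t \<in> carrier G" for t n
    using subgroup.m_closed[OF B b(1)[OF that]] g by auto
  have D_bound: "norm (D h t u) \<le> 2 * K"
    if "\<And>t. t \<in> carrier ?B \<Longrightarrow> norm (h t) \<le> K" "t \<in> carrier G" for h K t u
  proof -
    have "norm (D h t u) \<le> norm (h (\<beta> t \<otimes> g (\<nu> u))) + norm (h (\<beta> t \<otimes> g' (\<nu> u)))"
      unfolding D_def by (rule norm_triangle_ineq4)
    also have "\<dots> \<le> K + K" by (intro add_mono that(1)) (use mem that(2) in auto)
    finally show ?thesis by simp
  qed
  have I_bound: "norm (I h t) \<le> C * (2 * K)"
    if "\<And>t. t \<in> carrier ?B \<Longrightarrow> norm (h t) \<le> K" "0 \<le> K" "t \<in> carrier G" for h K t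
    unfolding I_def by (rule C) (use D_bound[of h K t, OF that(1) that(3)] that(2) in auto)
  have D_bounded: "bounded (D h t ` carrier G)" if "bounded (h ` carrier ?B)" "t \<in> carrier G" for h t
  proof -
    obtain K where K: "\<And>t. t \<in> carrier ?B \<Longrightarrow> norm (h t) \<le> K" using \<open>bounded (h ` carrier ?B)\<close> unfolding bounded_iff by blast
    show ?thesis using D_bound[of h K t, OF K that(2)] unfolding bounded_iff by blast
  qed
  have I_bounded: "bounded (I h ` carrier G)" if "bounded (h ` carrier ?B)" for h
  proof -
    obtain K where K: "\<And>t. t \<in> carrier ?B \<Longrightarrow> norm (h t) \<le> K" using \<open>bounded (h ` carrier ?B)\<close> unfolding bounded_iff by blast
    have "0 \<le> K" using K[OF B.one_closed] norm_ge_zero order_trans by blast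
    then show ?thesis using I_bound[of h K, OF K] unfolding bounded_iff by blast
  qed
  have L_cong: "L h = L k" if hk: "\<And>t. t \<in> carrier ?B \<Longrightarrow> h t = k t" for h k
  proof -
    have "D h t u = D k t u" if "t \<in> carrier G" for t u
      using hk mem[OF that] unfolding D_def by simp
    then have "linf_functional G (D h t) = linf_functional G (D k t)" if "t \<in> carrier G" for t
      using that by (intro linf_cong) simp
    then have "linf_functional G (I h) = linf_functional G (I k)"
      by (intro linf_cong) (simp add: I_def)
    then show ?thesis by (simp add: L_def)
  qed
  have Gam_linf: "\<Gamma> (linf_functional ?B h) = L h" if "bounded (h ` carrier ?B)" for h
  proof -
    have "\<Gamma> (linf_functional ?B h) = L (\<lambda>t. linf_functional ?B h (point_mass t))"
      unfolding \<Gamma>_def using linf_in_dual[OF that] by simp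
    also have "\<dots> = L h" by (rule L_cong) (rule linf_point_mass)
    finally show ?thesis .
  qed
  have Gam: "\<Gamma> \<in> ell1_bidual ?B"
  proof (rule bidualI[where L = L and C = "C * (C * 2)"])
    fix h k :: "'a \<Rightarrow> complex" assume hk: "bounded (h ` carrier ?B)" "bounded (k ` carrier ?B)"
    have "D (\<lambda>t. h t + k t) t = (\<lambda>u. D h t u + D k t u)" for t by (auto simp: D_def)
    then have "linf_functional G (I (\<lambda>t. h t + k t)) = linf_functional G (\<lambda>t. I h t + I k t)"
      by (intro linf_cong) (simp add: I_def bidual_add[OF M D_bounded[OF hk(1)] D_bounded[OF hk(2)]])
    then show "L (\<lambda>t. h t + k t) = L h + L k"
      by (simp add: L_def bidual_add[OF M I_bounded[OF hk(1)] I_bounded[OF hk(2)]])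
  next
    fix c :: complex and h :: "'a \<Rightarrow> complex" assume h: "bounded (h ` carrier ?B)"
    have "D (\<lambda>t. c * h t) t = (\<lambda>u. c * D h t u)" for t by (auto simp: D_def right_diff_distrib)
    then have "linf_functional G (I (\<lambda>t. c * h t)) = linf_functional G (\<lambda>t. c * I h t)"
      by (intro linf_cong) (simp add: I_def bidual_scale[OF M D_bounded[OF h]])
    then show "L (\<lambda>t. c * h t) = c * L h"
      by (simp add: L_def bidual_scale[OF M I_bounded[OF h]])
  next
    fix h :: "'a \<Rightarrow> complex" and K
    assume h: "\<And>t. t \<in> carrier ?B \<Longrightarrow> norm (h t) \<le> K" and K: "0 \<le> K"
    have "norm (L h) \<le> C * (C * (2 * K))"
      unfolding L_def by (rule C) (use I_bound[of h K, OF h K] K C0 in auto)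
    then show "norm (L h) \<le> C * (C * 2) * K" by (simp add: mult_ac)
  next
    show "carrier ?B \<noteq> {}" using B.one_closed by blast
  next
    show "\<Gamma> \<phi> = 0" if "\<phi> \<notin> dual (ell1 ?B) (ell1_norm ?B)" for \<phi>
      using that by (simp add: \<Gamma>_def)
  next
    show "L h = L k" if "\<And>t. t \<in> carrier ?B \<Longrightarrow> h t = k t" for h k by (rule L_cong[OF that])
  qed (rule Gam_linf)
  show thesis
  proof (rule that[of \<Gamma> f])
    show "\<Gamma> \<in> invariant_differences ?B"
    proof (rule B.invariant_differenceI[OF Gam])
      have "D (\<lambda>_. 1) t = (\<lambda>_. 0)" for t by (auto simp: D_def)
      then have "I (\<lambda>_. 1) = (\<lambda>_. 0)" using bidual_zero_fun[OF M] by (intro ext) (simp add: I_def)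
      then show "\<Gamma> (one_functional ?B) = 0"
        using Gam_linf[OF bounded_const] bidual_zero_fun[OF M] by (simp add: L_def)
    next
      fix s and h :: "'a \<Rightarrow> complex" assume s: "s \<in> carrier ?B" and h: "bounded (h ` carrier ?B)"
      have sB: "s \<in> B" "s \<in> carrier G" using s BG by auto
      have "D (\<lambda>u. h (s \<otimes> u)) t = D h (s \<otimes> t)" if t: "t \<in> carrier G" for t
      proof
        fix u
        have "\<beta> t \<in> carrier G" "g (\<nu> u) \<in> carrier G" "g' (\<nu> u) \<in> carrier G"
          using b(1)[OF t] g BG by auto
        then show "D (\<lambda>u. h (s \<otimes> u)) t u = D h (s \<otimes> t) u"
          unfolding D_def b(2)[OF sB(1) t] using sB(2) by (simp add: m_assoc)
      qed
      then have "linf_functional G (I (\<lambda>u. h (s \<otimes> u))) = linf_functional G (\<lambda>t. I h (s \<otimes> t))"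
        by (intro linf_cong) (simp add: I_def)
      then have "L (\<lambda>u. h (s \<otimes> u)) = L h"
        using inv[OF sB(2) I_bounded[OF h]] by (simp add: L_def)
      then show "\<Gamma> (linf_functional ?B (\<lambda>u. h (s \<otimes>\<^bsub>?B\<^esub> u))) = \<Gamma> (linf_functional ?B h)"
        using Gam_linf[OF h] Gam_linf[OF B.bounded_translate[OF h s]] by simp
    qed
    have "I f t = 1" if t: "t \<in> carrier G" for t
    proof -
      obtain N where N: "\<forall>n\<ge>N. f (\<beta> t \<otimes> g n) = 1 \<and> f (\<beta> t \<otimes> g' n) = 0"
        using lim[of "\<beta> t"] b(1)[OF t] by auto
      show ?thesis
        using nu[rule_format, of N "\<lambda>n. f (\<beta> t \<otimes> g n) - f (\<beta> t \<otimes> g' n)" 1] N unfolding I_def D_def by simp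
    qed
    then have "linf_functional G (I f) = one_functional G" by (rule linf_cong)
    then have "L f = 1" by (simp add: L_def one)
    moreover have "bounded (f ` carrier ?B)" using f by (auto simp: bounded_iff)
    ultimately show "\<Gamma> (linf_functional ?B f) = 1" by (simp add: Gam_linf)
  qed (rule f)
qed

text \<open>Trivial intersection makes the factorisation of an element of \<open>B <#> C\<close>
  unique, so a bounded \<open>l\<close> with \<open>l (b \<otimes> c) = f b * k c\<close> exists.
  Applying \<open>\<Delta>\<close> to its translate by \<open>t\<close> in \<open>B\<close> gives
  \<open>f t\<close>, and \<open>\<Gamma>\<close> sends \<open>f\<close> to 1.\<close>

lemma arens_product_nonzero:
  assumes B: "subgroup B G" and C: "subgroup C G" and triv: "B \<inter> C \<subseteq> {\<one>}"
    and Gam: "\<Gamma> \<in> ell1_bidual (G\<lparr>carrier := B\<rparr>)" and Del: "\<Delta> \<in> ell1_bidual (G\<lparr>carrier := C\<rparr>)"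
    and f: "\<And>t. norm (f t :: complex) \<le> 1" and k: "\<And>t. norm (k t :: complex) \<le> 1"
    and Gf: "\<Gamma> (linf_functional (G\<lparr>carrier := B\<rparr>) f) = 1"
    and Dk: "\<Delta> (linf_functional (G\<lparr>carrier := C\<rparr>) k) = 1"
  shows "arens G (bidual_inclusion G B \<Gamma>) (bidual_inclusion G C \<Delta>) \<noteq> 0"
proof -
  have BG: "B \<subseteq> carrier G" and CG: "C \<subseteq> carrier G" using B C subgroup.subset by auto
  have bounded: "bounded (h ` A)" if "\<And>t. norm (h t :: complex) \<le> 1" for h and A :: "'a set"
    using that by (auto simp: bounded_iff)
  define l where "l w = (if w \<in> B <#> C then
    (let p = SOME p. fst p \<in> B \<and> snd p \<in> C \<and> w = fst p \<otimes> snd p in f (fst p) * k (snd p)) else 0)" for w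
  have l_bound: "norm (l w) \<le> 1" for w
    using mult_le_one[OF f _ k] by (auto simp: l_def Let_def norm_mult)
  have l: "l (b \<otimes> c) = f b * k c" if bc: "b \<in> B" "c \<in> C" for b c
  proof -
    let ?P = "\<lambda>p. fst p \<in> B \<and> snd p \<in> C \<and> b \<otimes> c = fst p \<otimes> snd p"
    have P: "?P (SOME p. ?P p)" by (rule someI[of ?P "(b, c)"]) (use bc in auto)
    obtain b' c' where p1: "(SOME p. ?P p) = (b', c')" by (rule prod.exhaust)
    note p = p1 P[unfolded p1 fst_conv snd_conv, THEN conjunct1]
      P[unfolded p1 fst_conv snd_conv, THEN conjunct2, THEN conjunct1]
      P[unfolded p1 fst_conv snd_conv, THEN conjunct2, THEN conjunct2]
    have g: "b \<in> carrier G" "c \<in> carrier G" "b' \<in> carrier G" "c' \<in> carrier G" using bc p BG CG by auto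
    \<comment> \<open>Two factorisations of one element differ by an element lying both in
      \<open>B\<close> and in \<open>C\<close>.\<close>
    have "inv b' \<otimes> b = inv b' \<otimes> (b \<otimes> c) \<otimes> inv c" using g by (simp add: m_assoc)
    also have "\<dots> = inv b' \<otimes> (b' \<otimes> c') \<otimes> inv c" by (simp only: p(4))
    also have "\<dots> = c' \<otimes> inv c" using g by (simp add: m_assoc[symmetric])
    finally have "inv b' \<otimes> b = c' \<otimes> inv c" .
    moreover have "inv b' \<otimes> b \<in> B" using bc p subgroup.m_closed[OF B] subgroup.m_inv_closed[OF B] by blast
    moreover have "c' \<otimes> inv c \<in> C" using bc p subgroup.m_closed[OF C] subgroup.m_inv_closed[OF C] by blast
    ultimately have "inv b' \<otimes> b = \<one>" "c' \<otimes> inv c = \<one>" using triv by auto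
    moreover have "b = b' \<otimes> (inv b' \<otimes> b)" "c' = (c' \<otimes> inv c) \<otimes> c"
      using g by (simp add: m_assoc[symmetric], simp add: m_assoc)
    ultimately have "b = b'" "c = c'" using g by simp_all
    moreover have "b \<otimes> c \<in> B <#> C" using bc by (auto simp: set_mult_def)
    ultimately show ?thesis unfolding l_def Let_def p(1) by simp
  qed
  have bl: "bounded (l ` carrier G)" by (rule bounded[OF l_bound])
  have Db: "bidual_inclusion G C \<Delta> \<in> ell1_bidual G" by (rule bidual_inclusion_bidual[OF C Del])
  let ?F = "\<lambda>t. bidual_inclusion G C \<Delta> (linf_functional G (\<lambda>u. l (t \<otimes> u)))"
  have "?F t = f t" if t: "t \<in> B" for t
  proof -
    have "?F t = \<Delta> (linf_functional (G\<lparr>carrier := C\<rparr>) (\<lambda>u. l (t \<otimes> u)))"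
      by (rule bidual_inclusion_linf[OF C bounded]) (rule l_bound)
    also have "linf_functional (G\<lparr>carrier := C\<rparr>) (\<lambda>u. l (t \<otimes> u)) = linf_functional (G\<lparr>carrier := C\<rparr>) (\<lambda>u. f t * k u)"
      by (rule linf_cong) (simp add: l t)
    also have "\<Delta> \<dots> = f t" using bidual_scale[OF Del bounded[OF k]] Dk by simp
    finally show ?thesis .
  qed
  then have F: "linf_functional (G\<lparr>carrier := B\<rparr>) ?F = linf_functional (G\<lparr>carrier := B\<rparr>) f"
    by (intro linf_cong) simp
  have "arens G (bidual_inclusion G B \<Gamma>) (bidual_inclusion G C \<Delta>) (linf_functional G l) = 1"
    unfolding arens_linf[OF Db bl] bidual_inclusion_linf[OF B bidual_translates_bounded[OF Db bl]] F by (rule Gf)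
  then show ?thesis by auto
qed

section \<open>Subnormal subgroups of just infinite groups\<close>

text \<open>Finite index as the existence of a finite \<open>F\<close> such that every element has
  the form \<open>h \<otimes> f\<close>. Being elementwise, this form survives a change of subgroup
  or of ambient group.\<close>

lemma finite_index_iff:
  assumes H: "subgroup H G"
  shows "finite (rcosets H) \<longleftrightarrow> (\<exists>F. finite F \<and> F \<subseteq> carrier G \<and> (\<forall>x\<in>carrier G. \<exists>f\<in>F. x \<otimes> inv f \<in> H))"
    (is "_ \<longleftrightarrow> ?R")
proof
  have HG: "H \<subseteq> carrier G" using H subgroup.subset by blast
  assume fin: "finite (rcosets H)"
  define r where "r C = (SOME x. x \<in> C)" for C :: "'a set"
  have r: "r (H #> x) \<in> H #> x" if "x \<in> carrier G" for x
    unfolding r_def by (rule someI[of _ x]) (rule rcos_self[OF that H])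
  have "x \<otimes> inv (r (H #> x)) \<in> H" if x: "x \<in> carrier G" for x
  proof -
    obtain h where h: "h \<in> H" "r (H #> x) = h \<otimes> x" using r[OF x] by (auto simp: r_coset_def)
    have "x \<otimes> inv (h \<otimes> x) = inv h"
      using h(1) x HG by (simp add: subset_iff inv_mult_group m_assoc[symmetric])
    then show ?thesis using h subgroup.m_inv_closed[OF H] by simp
  qed
  moreover have "r ` (rcosets H) \<subseteq> carrier G"
    using r r_coset_subset_G[OF HG] by (auto simp: RCOSETS_def)
  moreover have "r (H #> x) \<in> r ` (rcosets H)" if "x \<in> carrier G" for x
    using that by (auto simp: RCOSETS_def)
  ultimately show ?R using fin by (intro exI[of _ "r ` (rcosets H)"]) blast
next
  have HG: "H \<subseteq> carrier G" using H subgroup.subset by blast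
  assume ?R
  then obtain F where F: "finite F" "F \<subseteq> carrier G" "\<And>x. x \<in> carrier G \<Longrightarrow> \<exists>f\<in>F. x \<otimes> inv f \<in> H" by blast
  have "rcosets H \<subseteq> (\<lambda>f. H #> f) ` F"
  proof
    fix C assume "C \<in> rcosets H"
    then obtain x where x: "x \<in> carrier G" "C = H #> x" by (auto simp: RCOSETS_def)
    obtain f where f: "f \<in> F" "x \<otimes> inv f \<in> H" using F(3)[OF x(1)] by blast
    have fG: "f \<in> carrier G" using f F by blast
    have "x = (x \<otimes> inv f) \<otimes> f" using x fG by (simp add: m_assoc)
    then have "x \<in> H #> f" using f(2) unfolding r_coset_def by blast
    then have "C = H #> f" using repr_independence[OF _ fG H] x by simp
    then show "C \<in> (\<lambda>f. H #> f) ` F" using f by blast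
  qed
  then show "finite (rcosets H)" using F(1) finite_surj by blast
qed

lemma finite_index_trans:
  assumes H: "subgroup H G" and K: "subgroup K (G\<lparr>carrier := H\<rparr>)"
    and "finite (rcosets H)" and "finite (rcosets\<^bsub>G\<lparr>carrier := H\<rparr>\<^esub> K)"
  shows "finite (rcosets K)"
proof -
  have HG: "H \<subseteq> carrier G" using H subgroup.subset by blast
  interpret H: group "G\<lparr>carrier := H\<rparr>" by (rule subgroup_imp_group[OF H])
  obtain F where F: "finite F" "F \<subseteq> carrier G" "\<And>x. x \<in> carrier G \<Longrightarrow> \<exists>f\<in>F. x \<otimes> inv f \<in> H"
    using assms(3) finite_index_iff[OF H] by blast
  obtain E where E: "finite E" "E \<subseteq> H" "\<And>x. x \<in> H \<Longrightarrow> \<exists>f\<in>E. x \<otimes> inv f \<in> K"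
    using assms(4) unfolding H.finite_index_iff[OF K] using m_inv_consistent[OF H] by (auto simp: subset_iff)
  have "\<exists>f\<in>(\<lambda>(e, f). e \<otimes> f) ` (E \<times> F). x \<otimes> inv f \<in> K" if x: "x \<in> carrier G" for x
  proof -
    obtain f where f: "f \<in> F" "x \<otimes> inv f \<in> H" using F(3)[OF x] by blast
    obtain e where e: "e \<in> E" "x \<otimes> inv f \<otimes> inv e \<in> K" using E(3)[OF f(2)] by blast
    have c: "e \<in> carrier G" "f \<in> carrier G" using e f E F HG by auto
    have "x \<otimes> inv (e \<otimes> f) \<in> K" using e(2) c x by (simp add: inv_mult_group m_assoc)
    then show ?thesis using e f by (intro bexI[of _ "e \<otimes> f"]) auto
  qed
  moreover have "(\<lambda>(e, f). e \<otimes> f) ` (E \<times> F) \<subseteq> carrier G" using E(2) F(2) HG by (auto intro!: m_closed)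
  ultimately show ?thesis
    unfolding finite_index_iff[OF incl_subgroup[OF H K]] using E(1) F(1)
    by (intro exI[of _ "(\<lambda>(e, f). e \<otimes> f) ` (E \<times> F)"]) auto
qed

lemma finite_index_mono:
  assumes "subgroup K G" "subgroup H G" "K \<subseteq> H" "finite (rcosets K)"
  shows "finite (rcosets H)"
  using assms(3,4) unfolding finite_index_iff[OF assms(1)] finite_index_iff[OF assms(2)] by (meson subsetD)

lemma finite_index_infinite:
  assumes H: "subgroup H G" and fin: "finite (rcosets H)" and inf: "infinite (carrier G)"
  shows "infinite H"
proof
  assume "finite H"
  then have "finite C" if "C \<in> rcosets H" for C using that by (auto simp: RCOSETS_def r_coset_def)
  then have "finite (\<Union>(rcosets H))" using fin by auto
  then show False using inf rcosets_part_G[OF H] by simp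
qed

text \<open>\<open>N\<close> is the intersection of the conjugates of \<open>K\<close>, which is the
  kernel of the right action on the cosets of \<open>K\<close>. That action takes place on a finite
  set, so the kernel has finite index.\<close>

lemma finite_index_normal_core:
  assumes K: "subgroup K G" and fin: "finite (rcosets K)"
  obtains N where "N \<lhd> G" "finite (rcosets N)" "N \<subseteq> K"
proof -
  have KG: "K \<subseteq> carrier G" using K subgroup.subset by blast
  define N where "N = {x \<in> carrier G. \<forall>g\<in>carrier G. g \<otimes> x \<otimes> inv g \<in> K}"
  have N: "subgroup N G"
  proof (rule subgroupI)
    show "N \<subseteq> carrier G" by (auto simp: N_def)
    show "N \<noteq> {}" using subgroup.one_closed[OF K] by (auto simp: N_def intro!: exI[of _ \<one>])
    fix a assume a: "a \<in> N"
    have "g \<otimes> inv a \<otimes> inv g \<in> K" if g: "g \<in> carrier G" for g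
    proof -
      have "inv (g \<otimes> a \<otimes> inv g) \<in> K" using a g subgroup.m_inv_closed[OF K] by (auto simp: N_def)
      then show ?thesis using a g by (simp add: inv_mult_group m_assoc N_def)
    qed
    then show "inv a \<in> N" using a by (simp add: N_def)
    fix b assume b: "b \<in> N"
    have "g \<otimes> (a \<otimes> b) \<otimes> inv g \<in> K" if g: "g \<in> carrier G" for g
    proof -
      have "(g \<otimes> a \<otimes> inv g) \<otimes> (g \<otimes> b \<otimes> inv g) \<in> K" using a b g subgroup.m_closed[OF K] by (auto simp: N_def)
      also have "(g \<otimes> a \<otimes> inv g) \<otimes> (g \<otimes> b \<otimes> inv g) = g \<otimes> (a \<otimes> b) \<otimes> inv g"
        using a b g by (simp add: N_def m_assoc) (simp add: m_assoc[symmetric])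
      finally show ?thesis .
    qed
    then show "a \<otimes> b \<in> N" using a b by (simp add: N_def)
  qed
  have norm: "N \<lhd> G"
    unfolding normal_inv_iff
  proof (intro conjI ballI N)
    fix x n assume x: "x \<in> carrier G" and n: "n \<in> N"
    have "g \<otimes> (x \<otimes> n \<otimes> inv x) \<otimes> inv g \<in> K" if g: "g \<in> carrier G" for g
    proof -
      have "(g \<otimes> x) \<otimes> n \<otimes> inv (g \<otimes> x) \<in> K" using x n g by (auto simp: N_def)
      then show ?thesis using x n g by (simp add: N_def inv_mult_group m_assoc)
    qed
    then show "x \<otimes> n \<otimes> inv x \<in> N" using x n by (simp add: N_def)
  qed
  have NK: "N \<subseteq> K"
  proof
    fix x assume "x \<in> N"
    then have "\<one> \<otimes> x \<otimes> inv \<one> \<in> K" "x \<in> carrier G" unfolding N_def by blast+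
    then show "x \<in> K" by simp
  qed
  obtain F where F: "finite F" "F \<subseteq> carrier G" "\<And>x. x \<in> carrier G \<Longrightarrow> \<exists>f\<in>F. x \<otimes> inv f \<in> K"
    using fin finite_index_iff[OF K] by blast
  \<comment> \<open>\<open>q x\<close> records the action of \<open>x\<close>: the pair
    \<open>(f, f')\<close> belongs to it when \<open>x\<close> sends the coset of \<open>f\<close>
    to the coset of \<open>f'\<close>. Equal records mean equal cosets of \<open>N\<close>.\<close>
  define q where "q x = {(f, f'). f \<in> F \<and> f' \<in> F \<and> f \<otimes> x \<otimes> inv f' \<in> K}" for x
  have diff: "x \<otimes> inv y \<in> N" if xy: "x \<in> carrier G" "y \<in> carrier G" and q: "q x = q y" for x y
  proof -
    have "g \<otimes> (x \<otimes> inv y) \<otimes> inv g \<in> K" if g: "g \<in> carrier G" for g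
    proof -
      obtain f where f: "f \<in> F" "g \<otimes> inv f \<in> K" using F(3)[OF g] by blast
      have fG: "f \<in> carrier G" using f F by blast
      obtain f' where f': "f' \<in> F" "f \<otimes> x \<otimes> inv f' \<in> K" using F(3)[of "f \<otimes> x"] fG xy by auto
      have f'G: "f' \<in> carrier G" using f' F by blast
      have "(f, f') \<in> q y" using q f f' unfolding q_def by blast
      then have y: "f \<otimes> y \<otimes> inv f' \<in> K" unfolding q_def by simp
      \<comment> \<open>The common \<open>f'\<close> cancels in the middle, and conjugating by
        \<open>g \<otimes> inv f\<close> in \<open>K\<close> replaces the representative
        \<open>f\<close> by \<open>g\<close>.\<close>
      have "(g \<otimes> inv f) \<otimes> ((f \<otimes> x \<otimes> inv f') \<otimes> inv (f \<otimes> y \<otimes> inv f')) \<otimes> inv (g \<otimes> inv f) \<in> K"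
        using f(2) f'(2) y subgroup.m_closed[OF K] subgroup.m_inv_closed[OF K] by blast
      moreover have "(f \<otimes> x \<otimes> inv f') \<otimes> inv (f \<otimes> y \<otimes> inv f') = f \<otimes> (x \<otimes> inv y) \<otimes> inv f"
        using fG f'G xy by (simp add: inv_mult_group m_assoc) (simp add: m_assoc[symmetric])
      moreover have "(g \<otimes> inv f) \<otimes> (f \<otimes> (x \<otimes> inv y) \<otimes> inv f) \<otimes> inv (g \<otimes> inv f) = g \<otimes> (x \<otimes> inv y) \<otimes> inv g"
      proof -
        have "inv f \<otimes> (f \<otimes> w) = w" if "w \<in> carrier G" for w
          using fG that by (simp add: m_assoc[symmetric])
        then show ?thesis using fG g xy by (simp add: inv_mult_group m_assoc)
      qed
      ultimately show ?thesis by simp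
    qed
    then show ?thesis using xy by (simp add: N_def)
  qed
  have "q ` carrier G \<subseteq> Pow (F \<times> F)" by (auto simp: q_def)
  then have fq: "finite (q ` carrier G)" using F(1) by (meson finite_Pow_iff finite_SigmaI finite_subset)
  define s where "s v = (SOME x. x \<in> carrier G \<and> q x = v)" for v
  have s: "s (q x) \<in> carrier G \<and> q (s (q x)) = q x" if "x \<in> carrier G" for x
    unfolding s_def by (rule someI[of _ x]) (simp add: that)
  have "finite (rcosets N)"
    unfolding finite_index_iff[OF N]
  proof (intro exI[of _ "s ` q ` carrier G"] conjI ballI)
    show "\<exists>f\<in>s ` q ` carrier G. x \<otimes> inv f \<in> N" if "x \<in> carrier G" for x
      using that s[OF that] diff[of x "s (q x)"] by auto
  qed (use fq s in auto)
  then show thesis using that norm NK by blast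
qed

section \<open>Subnormal subgroups in the hereditarily just infinite case\<close>

lemma normal_restrict_Int:
  assumes N: "subgroup N G" and J: "subgroup J G" and NJ: "N \<subseteq> J" and K: "K \<lhd> G\<lparr>carrier := J\<rparr>"
  shows "N \<inter> K \<lhd> G\<lparr>carrier := N\<rparr>"
proof -
  interpret N: group "G\<lparr>carrier := N\<rparr>" by (rule subgroup_imp_group[OF N])
  interpret J: group "G\<lparr>carrier := J\<rparr>" by (rule subgroup_imp_group[OF J])
  have KG: "subgroup K G" using incl_subgroup[OF J] K normal_imp_subgroup by blast
  have "subgroup (N \<inter> K) (G\<lparr>carrier := N\<rparr>)"
    by (rule subgroup_incl[OF subgroups_Inter_pair[OF N KG] N]) auto
  moreover have "x \<otimes> h \<otimes> inv x \<in> N \<inter> K" if "x \<in> N" "h \<in> N \<inter> K" for x h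
  proof
    show "x \<otimes> h \<otimes> inv x \<in> N"
      using that subgroup.m_closed[OF N] subgroup.m_inv_closed[OF N] by auto
    have "x \<in> J" using that NJ by blast
    then show "x \<otimes> h \<otimes> inv x \<in> K"
      using that K m_inv_consistent[OF J] unfolding J.normal_inv_iff by auto
  qed
  ultimately show ?thesis
    unfolding N.normal_inv_iff using m_inv_consistent[OF N] by auto
qed

text \<open>Distinct elements of \<open>K\<close> lie in distinct cosets of \<open>N\<close>, so
  \<open>K\<close> embeds in a finite set.\<close>

lemma finite_if_trivial_Int_normal:
  assumes N: "N \<lhd> G" and fin: "finite (rcosets N)" and K: "subgroup K G" and triv: "N \<inter> K = {\<one>}"
  shows "finite K"
proof -
  have Ns: "subgroup N G" using N normal_imp_subgroup by blast
  have KG: "K \<subseteq> carrier G" using K subgroup.subset by blast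
  have "inj_on (\<lambda>x. N #> x) K"
  proof
    fix x y assume xy: "x \<in> K" "y \<in> K" "N #> x = N #> y"
    have c: "x \<in> carrier G" "y \<in> carrier G" using xy KG by auto
    have "x \<in> N #> y" using rcos_self[OF c(1) Ns] xy(3) by simp
    then obtain n where n: "n \<in> N" "x = n \<otimes> y" by (auto simp: r_coset_def)
    have nG: "n \<in> carrier G" using n Ns subgroup.subset by blast
    have "n = x \<otimes> inv y" using n nG c by (simp add: m_assoc)
    then have "n \<in> K" using xy subgroup.m_closed[OF K] subgroup.m_inv_closed[OF K] by blast
    then have "n = \<one>" using n triv by blast
    then show "x = y" using n c by simp
  qed
  moreover have "(\<lambda>x. N #> x) ` K \<subseteq> rcosets N" using KG by (auto simp: RCOSETS_def)
  ultimately show ?thesis using fin inj_on_finite by blast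
qed

text \<open>Induction down the chain. If \<open>J i\<close> contains \<open>N\<close>, then
  \<open>N \<inter> J (Suc i)\<close> is normal in the just infinite group \<open>N\<close>. A
  trivial intersection makes \<open>J (Suc i)\<close> finite; otherwise the intersection has finite
  index in \<open>N\<close>, hence in \<open>G\<close>, and its normal core continues the
  induction.\<close>

lemma hereditarily_just_infinite_subnormal:
  assumes hji: "hereditarily_just_infinite G" and sn: "subnormal K G"
  shows "finite K \<or> (\<exists>N. N \<lhd> G \<and> finite (rcosets N) \<and> N \<subseteq> K)"
proof -
  have inf: "infinite (carrier G)" using hji by (simp add: hereditarily_just_infinite_def)
  obtain n and J :: "nat \<Rightarrow> 'a set" where J0: "J 0 = carrier G" and Jn: "J n = K"
    and step: "\<And>i. i < n \<Longrightarrow> J (Suc i) \<lhd> G\<lparr>carrier := J i\<rparr>"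
    using sn by (auto simp: subnormal_def)
  have "subgroup (J i) G \<and> (finite (J i) \<or> (\<exists>N. N \<lhd> G \<and> finite (rcosets N) \<and> N \<subseteq> J i))" if "i \<le> n" for i
    using that
  proof (induction i)
    case 0
    have fin: "finite (rcosets (carrier G))"
      unfolding finite_index_iff[OF subgroup_self] by (intro exI[of _ "{\<one>}"]) auto
    obtain N where "N \<lhd> G" "finite (rcosets N)" "N \<subseteq> carrier G"
      by (rule finite_index_normal_core[OF subgroup_self fin])
    then show ?case using J0 subgroup_self by auto
  next
    case (Suc i)
    then have Ji: "subgroup (J i) G" and IH: "finite (J i) \<or> (\<exists>N. N \<lhd> G \<and> finite (rcosets N) \<and> N \<subseteq> J i)"
      and nrm: "J (Suc i) \<lhd> G\<lparr>carrier := J i\<rparr>" using step by auto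
    have sub: "subgroup (J (Suc i)) G" using incl_subgroup[OF Ji] nrm normal_imp_subgroup by blast
    have "J (Suc i) \<subseteq> J i" using subgroup.subset[OF normal_imp_subgroup[OF nrm]] by simp
    have "finite (J (Suc i)) \<or> (\<exists>N. N \<lhd> G \<and> finite (rcosets N) \<and> N \<subseteq> J (Suc i))"
      using IH
    proof
      assume "finite (J i)"
      then show ?thesis using \<open>J (Suc i) \<subseteq> J i\<close> finite_subset by blast
    next
      assume "\<exists>N. N \<lhd> G \<and> finite (rcosets N) \<and> N \<subseteq> J i"
      then obtain N where N: "N \<lhd> G" "finite (rcosets N)" "N \<subseteq> J i" by blast
      have Ns: "subgroup N G" using N normal_imp_subgroup by blast
      have M: "N \<inter> J (Suc i) \<lhd> G\<lparr>carrier := N\<rparr>" by (rule normal_restrict_Int[OF Ns Ji N(3) nrm])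
      show ?thesis
      proof (cases "N \<inter> J (Suc i) = {\<one>}")
        case True
        then show ?thesis using finite_if_trivial_Int_normal[OF N(1,2) sub] by blast
      next
        case False
        have "infinite N" by (rule finite_index_infinite[OF Ns N(2) inf])
        then have "N \<noteq> {\<one>}" by auto
        then have "just_infinite (G\<lparr>carrier := N\<rparr>)"
          using hji N(1) by (simp add: hereditarily_just_infinite_def)
        then have "finite (rcosets\<^bsub>G\<lparr>carrier := N\<rparr>\<^esub> (N \<inter> J (Suc i)))"
          using M False by (simp add: just_infinite_def)
        then have fin: "finite (rcosets (N \<inter> J (Suc i)))"
          by (rule finite_index_trans[OF Ns normal_imp_subgroup[OF M] N(2)])
        obtain N' where "N' \<lhd> G" "finite (rcosets N')" "N' \<subseteq> N \<inter> J (Suc i)"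
          by (rule finite_index_normal_core[OF subgroups_Inter_pair[OF Ns sub] fin])
        then show ?thesis by blast
      qed
    qed
    then show ?case using sub by blast
  qed
  then show ?thesis using Jn by blast
qed

section \<open>Joins and conjugates of normal subgroups\<close>

lemma finite_normal_subgroups_join:
  assumes "finite S" "\<And>A. A \<in> S \<Longrightarrow> A \<lhd> G" "\<And>A. A \<in> S \<Longrightarrow> finite A"
  shows "\<exists>M. M \<lhd> G \<and> finite M \<and> \<Union>S \<subseteq> M"
  using assms
proof (induction S rule: finite_induct)
  case empty
  then show ?case using one_is_normal by (intro exI[of _ "{\<one>}"]) simp
next
  case (insert A S)
  then obtain M where M: "M \<lhd> G" "finite M" "\<Union>S \<subseteq> M" by auto
  have A: "A \<lhd> G" "finite A" using insert.prems by auto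
  have sub: "subgroup A G" "subgroup M G" using A(1) M(1) by (simp_all add: normal_imp_subgroup)
  then have c: "A \<subseteq> carrier G" "M \<subseteq> carrier G" using subgroup.subset by auto
  have "finite (A <#> M)" using A M by (auto simp: set_mult_def)
  moreover have "A \<subseteq> A <#> M"
    unfolding set_mult_def using subgroup.one_closed[OF sub(2)] c r_one by force
  moreover have "M \<subseteq> A <#> M"
    unfolding set_mult_def using subgroup.one_closed[OF sub(1)] c l_one by force
  ultimately show ?case
    using normal_subgroup_set_mult_closed[OF A(1) M(1)] M(3) by (intro exI[of _ "A <#> M"]) auto
qed

definition conjugate :: "'a \<Rightarrow> 'a set \<Rightarrow> 'a set" where
  "conjugate g A = (\<lambda>x. g \<otimes> x \<otimes> inv g) ` A"

lemma conjugate_conjugate: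
  assumes "g \<in> carrier G" "h \<in> carrier G" "A \<subseteq> carrier G"
  shows "conjugate g (conjugate h A) = conjugate (g \<otimes> h) A"
  using assms unfolding conjugate_def image_image
  by (intro image_cong refl) (simp add: subset_iff inv_mult_group m_assoc)

lemma conjugate_one: "A \<subseteq> carrier G \<Longrightarrow> conjugate \<one> A = A"
  by (force simp: conjugate_def subset_iff image_iff)

lemma conjugate_subset: "g \<in> carrier G \<Longrightarrow> A \<subseteq> carrier G \<Longrightarrow> conjugate g A \<subseteq> carrier G"
  by (auto simp: conjugate_def)

lemma inj_on_conjugation: "g \<in> carrier G \<Longrightarrow> inj_on (\<lambda>x. g \<otimes> x \<otimes> inv g) (carrier G)"
  by (auto simp: inj_on_def)

text \<open>Conjugation by \<open>g\<close> restricts to an automorphism of the normal subgroup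
  \<open>N\<close>, and automorphisms preserve normality.\<close>

lemma conjugate_normal:
  assumes N: "N \<lhd> G" and A: "A \<lhd> G\<lparr>carrier := N\<rparr>" and g: "g \<in> carrier G"
  shows "conjugate g A \<lhd> G\<lparr>carrier := N\<rparr>"
proof -
  interpret N: normal N G by (rule N)
  have Ns: "subgroup N G" using N normal_imp_subgroup by blast
  interpret NG: group "G\<lparr>carrier := N\<rparr>" by (rule subgroup_imp_group[OF Ns])
  have AG: "subgroup A G" using incl_subgroup[OF Ns] A normal_imp_subgroup by blast
  have AN: "A \<subseteq> N" using subgroup.subset[OF normal_imp_subgroup[OF A]] by simp
  have Ac: "A \<subseteq> carrier G" using AG subgroup.subset by blast
  have "subgroup (conjugate g A) G"
  proof (rule subgroupI)
    show "conjugate g A \<subseteq> carrier G" by (rule conjugate_subset[OF g Ac])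
    show "conjugate g A \<noteq> {}" using subgroup.one_closed[OF AG] by (auto simp: conjugate_def)
    fix a assume "a \<in> conjugate g A"
    then obtain x where x: "x \<in> A" "a = g \<otimes> x \<otimes> inv g" by (auto simp: conjugate_def)
    then have "inv a = g \<otimes> inv x \<otimes> inv g" using g Ac by (simp add: subset_iff inv_mult_group m_assoc)
    then show "inv a \<in> conjugate g A" using subgroup.m_inv_closed[OF AG x(1)] by (auto simp: conjugate_def)
    fix b assume "b \<in> conjugate g A"
    then obtain y where y: "y \<in> A" "b = g \<otimes> y \<otimes> inv g" by (auto simp: conjugate_def)
    have "a \<otimes> b = g \<otimes> (x \<otimes> y) \<otimes> inv g"
      using x y g Ac by (simp add: subset_iff m_assoc) (simp add: m_assoc[symmetric])
    then show "a \<otimes> b \<in> conjugate g A" using subgroup.m_closed[OF AG x(1) y(1)] by (auto simp: conjugate_def)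
  qed
  moreover have "conjugate g A \<subseteq> N" using N.inv_op_closed2[OF g] AN by (auto simp: conjugate_def)
  ultimately have "subgroup (conjugate g A) (G\<lparr>carrier := N\<rparr>)" by (rule subgroup_incl[OF _ Ns])
  moreover have "x \<otimes> h \<otimes> inv x \<in> conjugate g A" if x: "x \<in> N" and h: "h \<in> conjugate g A" for x h
  proof -
    obtain a where a: "a \<in> A" "h = g \<otimes> a \<otimes> inv g" using h by (auto simp: conjugate_def)
    \<comment> \<open>Conjugating \<open>g \<otimes> a \<otimes> inv g\<close> by \<open>x\<close>
      amounts to conjugating \<open>a\<close> by this \<open>y\<close> first and by \<open>g\<close>
      afterwards.\<close>
    define y where "y = inv g \<otimes> x \<otimes> g"
    have c: "x \<in> carrier G" "a \<in> carrier G" using x a Ac N.subset by auto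
    have y: "y \<in> N" unfolding y_def by (rule N.inv_op_closed1[OF g x])
    have "y \<otimes> a \<otimes> inv y \<in> A"
      using A a y m_inv_consistent[OF Ns] unfolding NG.normal_inv_iff by auto
    moreover have "g \<otimes> (y \<otimes> a \<otimes> inv y) \<otimes> inv g = x \<otimes> h \<otimes> inv x"
    proof -
      have "g \<otimes> (inv g \<otimes> w) = w" if "w \<in> carrier G" for w
        using g that by (simp add: m_assoc[symmetric])
      then show ?thesis unfolding y_def a(2) using g c by (simp add: inv_mult_group m_assoc)
    qed
    ultimately show ?thesis unfolding conjugate_def by (metis imageI)
  qed
  ultimately show ?thesis
    unfolding NG.normal_inv_iff using m_inv_consistent[OF Ns] by auto
qed

lemma conjugate_normal_self:
  assumes N: "subgroup N G" and A: "A \<lhd> G\<lparr>carrier := N\<rparr>" and x: "x \<in> N"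
  shows "conjugate x A = A"
proof -
  interpret NG: group "G\<lparr>carrier := N\<rparr>" by (rule subgroup_imp_group[OF N])
  have AG: "A \<subseteq> carrier G" using incl_subgroup[OF N] A normal_imp_subgroup subgroup.subset by blast
  have NG: "N \<subseteq> carrier G" using N subgroup.subset by blast
  have sub: "conjugate y A \<subseteq> A" if "y \<in> N" for y
    using A that m_inv_consistent[OF N] unfolding NG.normal_inv_iff by (auto simp: conjugate_def)
  have "A = conjugate x (conjugate (inv x) A)"
    using x NG AG by (simp add: conjugate_conjugate conjugate_one subset_iff)
  also have "\<dots> \<subseteq> conjugate x A"
    using sub[OF subgroup.m_inv_closed[OF N x]] by (auto simp: conjugate_def)
  finally show ?thesis using sub[OF x] by blast
qed

text \<open>Elements of \<open>N\<close> fix \<open>A\<close> under conjugation, so a conjugate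
  depends only on the left coset of \<open>g\<close>. As \<open>finite_index_iff\<close> concerns
  right cosets, it is applied to \<open>inv g\<close>.\<close>

lemma finite_conjugates:
  assumes N: "subgroup N G" and fin: "finite (rcosets N)" and A: "A \<lhd> G\<lparr>carrier := N\<rparr>"
  shows "finite ((\<lambda>g. conjugate g A) ` carrier G)"
proof -
  have AG: "A \<subseteq> carrier G" using incl_subgroup[OF N] A normal_imp_subgroup subgroup.subset by blast
  obtain F where F: "finite F" "F \<subseteq> carrier G" "\<And>x. x \<in> carrier G \<Longrightarrow> \<exists>f\<in>F. x \<otimes> inv f \<in> N"
    using fin finite_index_iff[OF N] by blast
  have "conjugate g A \<in> (\<lambda>f. conjugate (inv f) A) ` F" if g: "g \<in> carrier G" for g
  proof -
    obtain f where f: "f \<in> F" "inv g \<otimes> inv f \<in> N" using F(3)[of "inv g"] g by auto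
    have fG: "f \<in> carrier G" using f F by blast
    let ?n = "inv g \<otimes> inv f"
    have "conjugate (inv f) A = conjugate (g \<otimes> ?n) A" using g fG by (simp add: m_assoc[symmetric])
    also have "\<dots> = conjugate g (conjugate ?n A)" using g fG AG by (simp add: conjugate_conjugate)
    also have "\<dots> = conjugate g A" by (simp add: conjugate_normal_self[OF N A f(2)])
    finally show ?thesis using f by blast
  qed
  then show ?thesis using F(1) by (meson finite_imageI finite_subset image_subsetI)
qed

text \<open>A finite such \<open>A\<close> has finitely many conjugates, which generate a finite normal subgroup of \<open>G\<close>.\<close>

lemma just_infinite_normal_in_normal_infinite:
  assumes ji: "just_infinite G" and N: "N \<lhd> G" and fin: "finite (rcosets N)"
    and A: "A \<lhd> G\<lparr>carrier := N\<rparr>" and nontriv: "A \<noteq> {\<one>}"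
  shows "infinite A"
proof
  assume "finite A"
  have Ns: "subgroup N G" using N normal_imp_subgroup by blast
  interpret NG: group "G\<lparr>carrier := N\<rparr>" by (rule subgroup_imp_group[OF Ns])
  have As: "subgroup A G" using incl_subgroup[OF Ns] A normal_imp_subgroup by blast
  have AG: "A \<subseteq> carrier G" using As subgroup.subset by blast
  let ?S = "(\<lambda>g. conjugate g A) ` carrier G"
  \<comment> \<open>The conjugates are known to be normal in \<open>N\<close> only, so the finite
    join \<open>M\<close> is formed there. It bounds the subgroup \<open>?W\<close> that they
    generate, which is normal in \<open>G\<close>.\<close>
  have "\<exists>M. M \<lhd> G\<lparr>carrier := N\<rparr> \<and> finite M \<and> \<Union>?S \<subseteq> M"
  proof (rule NG.finite_normal_subgroups_join)
    show "finite ?S" by (rule finite_conjugates[OF Ns fin A])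
    show "B \<lhd> G\<lparr>carrier := N\<rparr>" if "B \<in> ?S" for B using that conjugate_normal[OF N A] by blast
    show "finite B" if "B \<in> ?S" for B using that \<open>finite A\<close> by (auto simp: conjugate_def)
  qed
  then obtain M where M: "M \<lhd> G\<lparr>carrier := N\<rparr>" "finite M" "\<Union>?S \<subseteq> M" by blast
  have Ms: "subgroup M G" using incl_subgroup[OF Ns] M normal_imp_subgroup by blast
  let ?W = "generate G (\<Union>?S)"
  have WM: "?W \<subseteq> M" by (rule generate_subgroup_incl[OF M(3) Ms])
  have W: "?W \<lhd> G"
  proof (rule normal_generateI)
    show "\<Union>?S \<subseteq> carrier G" using conjugate_subset[OF _ AG] by blast
    fix h g assume "h \<in> \<Union>?S" and g: "g \<in> carrier G"
    then obtain k where k: "k \<in> carrier G" "h \<in> conjugate k A" by auto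
    then have "g \<otimes> h \<otimes> inv g \<in> conjugate g (conjugate k A)" by (auto simp: conjugate_def)
    then show "g \<otimes> h \<otimes> inv g \<in> \<Union>?S" using conjugate_conjugate[OF g k(1) AG] g k(1) by auto
  qed
  have "A \<subseteq> \<Union>?S" using conjugate_one[OF AG] one_closed by blast
  then have "A \<subseteq> ?W" using generate.incl[of _ "\<Union>?S" G] by blast
  then have "?W \<noteq> {\<one>}" using nontriv subgroup.one_closed[OF As] by blast
  then have "finite (rcosets ?W)" using ji W by (simp add: just_infinite_def)
  then have "infinite ?W"
    using finite_index_infinite[OF normal_imp_subgroup[OF W]] ji by (simp add: just_infinite_def)
  then show False using WM M(2) finite_subset by blast
qed

section \<open>Infinite subnormal subgroups with trivial intersection\<close>

lemma subnormal_of_normal: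
  assumes "N \<lhd> G" "B \<lhd> G\<lparr>carrier := N\<rparr>"
  shows "subnormal B G"
  unfolding subnormal_def
proof (intro exI conjI allI impI)
  let ?K = "\<lambda>i::nat. if i = 0 then carrier G else if i = 1 then N else B"
  show "?K 0 = carrier G" "?K 2 = B" by simp_all
  show "?K (Suc i) \<lhd> G\<lparr>carrier := ?K i\<rparr>" if "i < 2" for i
    using that assms by (cases i) auto
qed

text \<open>\<open>B\<close> is a minimal kind of intersection of conjugates of \<open>L\<close>: by
  maximality of the family, each conjugate of \<open>B\<close> meets it trivially or contains it.
  Were all of them to contain it, \<open>B\<close> would be normal of finite index and would force
  \<open>L\<close> to have finite index.\<close>

lemma not_hereditarily_just_infinite_subnormal_pair:
  assumes ji: "just_infinite G" and not_hji: "\<not> hereditarily_just_infinite G"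
  obtains B C where "subnormal B G" "subnormal C G" "subgroup B G" "subgroup C G"
    "infinite B" "infinite C" "B \<inter> C \<subseteq> {\<one>}"
proof -
  have inf: "infinite (carrier G)" using ji by (simp add: just_infinite_def)
  obtain N where N: "N \<lhd> G" "N \<noteq> {\<one>}" "\<not> just_infinite (G\<lparr>carrier := N\<rparr>)"
    using not_hji inf by (auto simp: hereditarily_just_infinite_def)
  have Ns: "subgroup N G" using N normal_imp_subgroup by blast
  interpret NG: group "G\<lparr>carrier := N\<rparr>" by (rule subgroup_imp_group[OF Ns])
  have finN: "finite (rcosets N)" using ji N by (simp add: just_infinite_def)
  have "infinite N" by (rule finite_index_infinite[OF Ns finN inf])
  then obtain L where L: "L \<lhd> G\<lparr>carrier := N\<rparr>" "L \<noteq> {\<one>}" "infinite (rcosets\<^bsub>G\<lparr>carrier := N\<rparr>\<^esub> L)"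
    using N(3) by (auto simp: just_infinite_def)
  have Ls: "subgroup L G" using incl_subgroup[OF Ns] L normal_imp_subgroup by blast
  have LG: "L \<subseteq> carrier G" using Ls subgroup.subset by blast
  define conjs where "conjs = (\<lambda>g. conjugate g L) ` carrier G"
  have conjs_fin: "finite conjs" unfolding conjs_def by (rule finite_conjugates[OF Ns finN L(1)])
  have conjs_normal: "A \<lhd> G\<lparr>carrier := N\<rparr>" if "A \<in> conjs" for A
    using that conjugate_normal[OF N(1) L(1)] unfolding conjs_def by blast
  have conjs_sub: "A \<subseteq> carrier G" if "A \<in> conjs" for A
    using that conjugate_subset[OF _ LG] unfolding conjs_def by blast
  have conjs_conj: "conjugate g A \<in> conjs" if "A \<in> conjs" "g \<in> carrier G" for A g
    using that conjugate_conjugate[OF that(2) _ LG] unfolding conjs_def by auto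
  define fam where "fam = {S. S \<subseteq> conjs \<and> S \<noteq> {} \<and> \<Inter>S \<noteq> {\<one>}}"
  have "finite fam" unfolding fam_def using conjs_fin by simp
  moreover have "L \<in> conjs"
    unfolding conjs_def by (rule image_eqI[of _ _ \<one>]) (simp_all add: conjugate_one[OF LG])
  then have "{L} \<in> fam" using L(2) by (simp add: fam_def)
  ultimately obtain S where S: "S \<in> fam" and max: "\<And>T. T \<in> fam \<Longrightarrow> S \<subseteq> T \<Longrightarrow> S = T"
    using finite_has_maximal[of fam] by blast
  define B where "B = \<Inter>S"
  have S': "S \<subseteq> conjs" "S \<noteq> {}" "B \<noteq> {\<one>}" using S by (auto simp: fam_def B_def)
  have B: "B \<lhd> G\<lparr>carrier := N\<rparr>"
  proof -
    have "subgroup (\<Inter>S) (G\<lparr>carrier := N\<rparr>)"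
      using NG.subgroups_Inter[of S] S' conjs_normal normal_imp_subgroup by blast
    then show ?thesis
      using S' conjs_normal unfolding B_def NG.normal_inv_iff by blast
  qed
  have Bs: "subgroup B G" using incl_subgroup[OF Ns] B normal_imp_subgroup by blast
  have BG: "B \<subseteq> carrier G" using Bs subgroup.subset by blast
  have dichotomy: "B \<subseteq> conjugate g B" if g: "g \<in> carrier G" and nt: "B \<inter> conjugate g B \<noteq> {\<one>}" for g
  proof -
    obtain A where "A \<in> S" using S'(2) by blast
    moreover have "\<forall>A\<in>S. id A \<subseteq> carrier G" using S'(1) conjs_sub by auto
    ultimately have conjB: "conjugate g B = \<Inter>(conjugate g ` S)"
      using image_INT[OF inj_on_conjugation[OF g], of S id] unfolding B_def conjugate_def by simp
    have "\<Inter>(S \<union> conjugate g ` S) = B \<inter> conjugate g B"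
      unfolding conjB unfolding B_def by (rule Inter_Un_distrib)
    moreover have "S \<union> conjugate g ` S \<subseteq> conjs" using S'(1) conjs_conj[OF _ g] by blast
    ultimately have "S \<union> conjugate g ` S \<in> fam" using S'(2) nt by (simp add: fam_def)
    then have "conjugate g ` S \<subseteq> S" using max[of "S \<union> conjugate g ` S"] by blast
    then show ?thesis unfolding conjB unfolding B_def by blast
  qed
  have "\<exists>g\<in>carrier G. B \<inter> conjugate g B = {\<one>}"
  proof (rule ccontr)
    assume "\<not> ?thesis"
    then have le: "B \<subseteq> conjugate g B" if "g \<in> carrier G" for g using dichotomy that by blast
    have ge: "conjugate g B \<subseteq> B" if g: "g \<in> carrier G" for g
    proof -
      have "conjugate g B \<subseteq> conjugate g (conjugate (inv g) B)"
        using le[of "inv g"] g by (auto simp: conjugate_def)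
      then show ?thesis using g BG by (simp add: conjugate_conjugate conjugate_one)
    qed
    have "B \<lhd> G"
      unfolding normal_inv_iff using Bs ge by (auto simp: conjugate_def)
    then have finB: "finite (rcosets B)" using ji S'(3) by (simp add: just_infinite_def)
    obtain A where A: "A \<in> S" using S' by blast
    then obtain g where g: "g \<in> carrier G" "A = conjugate g L" using S'(1) by (auto simp: conjs_def)
    \<comment> \<open>\<open>B\<close> lies in some conjugate of \<open>L\<close>; conjugating back,
      with \<open>B\<close> contained in all its conjugates, places it in \<open>L\<close>
      itself.\<close>
    have "B \<subseteq> conjugate (inv g) B" using le g by simp
    also have "\<dots> \<subseteq> conjugate (inv g) (conjugate g L)"
      using A g unfolding B_def conjugate_def by (intro image_mono) auto
    also have "\<dots> = L" using g LG by (simp add: conjugate_conjugate conjugate_one)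
    finally have "B \<subseteq> L" .
    then have "finite (rcosets L)" using finite_index_mono[OF Bs Ls _ finB] by blast
    moreover have "rcosets\<^bsub>G\<lparr>carrier := N\<rparr>\<^esub> L \<subseteq> rcosets L"
      using subgroup.subset[OF Ns] by (auto simp: RCOSETS_def r_coset_def)
    ultimately show False using L(3) finite_subset by blast
  qed
  then obtain g where g: "g \<in> carrier G" "B \<inter> conjugate g B = {\<one>}" by blast
  have C: "conjugate g B \<lhd> G\<lparr>carrier := N\<rparr>" by (rule conjugate_normal[OF N(1) B g(1)])
  have infB: "infinite B" by (rule just_infinite_normal_in_normal_infinite[OF ji N(1) finN B S'(3)])
  then have "infinite (conjugate g B)"
    unfolding conjugate_def using finite_imageD inj_on_subset[OF inj_on_conjugation[OF g(1)] BG] by blast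
  moreover have "subgroup (conjugate g B) G" using incl_subgroup[OF Ns] C normal_imp_subgroup by blast
  ultimately show thesis
    using that[of B "conjugate g B"] subnormal_of_normal[OF N(1)] B C Bs infB g(2) by blast
qed

section \<open>From square zero back to hereditary just infiniteness\<close>

lemma D_sn_subset_A_sn: "D_sn G \<subseteq> A_sn G"
proof
  fix \<Gamma> assume "\<Gamma> \<in> D_sn G"
  then have "foldl (arens G) \<Gamma> [] \<in> {foldl (arens G) \<Gamma> \<Gamma>s |\<Gamma> \<Gamma>s. \<Gamma> \<in> D_sn G \<and> set \<Gamma>s \<subseteq> D_sn G}"
    by fastforce
  then show "\<Gamma> \<in> A_sn G" unfolding A_sn_def by (auto intro: cfun.span_base)
qed

lemma amenable_mean:
  assumes "amenable G"
  obtains M where "M \<in> ell1_bidual G" "M (one_functional G) = 1"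
    "\<And>s h. s \<in> carrier G \<Longrightarrow> bounded (h ` carrier G) \<Longrightarrow>
      M (linf_functional G (\<lambda>u. h (s \<otimes> u))) = M (linf_functional G h)"
proof -
  obtain M where M: "M \<in> ell1_bidual G" "M (one_functional G) = 1"
    "\<And>s. s \<in> carrier G \<Longrightarrow> arens G (delta G s) M = M"
    using assms by (auto simp: amenable_def)
  have "M (linf_functional G (\<lambda>u. h (s \<otimes> u))) = M (linf_functional G h)"
    if "s \<in> carrier G" "bounded (h ` carrier G)" for s h
    using arens_delta[OF that(1) M(1) that(2)] M(3)[OF that(1)] by simp
  then show thesis by (rule that[OF M(1,2)])
qed

text \<open>Single invariant differences already belong to \<open>A_sn\<close>, so one nonzero
  product of two of them, on \<open>B\<close> and on \<open>C\<close>, contradicts square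
  zero.\<close>

lemma hereditarily_just_infinite_if_A_sn_square_zero:
  assumes am: "amenable G" and ji: "just_infinite G" and zero: "square_zero G (A_sn G)"
  shows "hereditarily_just_infinite G"
proof (rule ccontr)
  assume "\<not> hereditarily_just_infinite G"
  then obtain B C where BC: "subnormal B G" "subnormal C G" "subgroup B G" "subgroup C G"
    "infinite B" "infinite C" "B \<inter> C \<subseteq> {\<one>}"
    by (rule not_hereditarily_just_infinite_subnormal_pair[OF ji])
  obtain M where M: "M \<in> ell1_bidual G" "M (one_functional G) = 1"
    "\<And>s h. s \<in> carrier G \<Longrightarrow> bounded (h ` carrier G) \<Longrightarrow>
      M (linf_functional G (\<lambda>u. h (s \<otimes> u))) = M (linf_functional G h)"
    by (rule amenable_mean[OF am]) blast
  obtain \<Gamma> and f :: "'a \<Rightarrow> complex" where G: "\<Gamma> \<in> invariant_differences (G\<lparr>carrier := B\<rparr>)"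
    "\<And>t. norm (f t) \<le> 1" "\<Gamma> (linf_functional (G\<lparr>carrier := B\<rparr>) f) = 1"
    by (rule nonzero_invariant_difference[OF BC(3,5) M]) blast+
  obtain \<Delta> and k :: "'a \<Rightarrow> complex" where D: "\<Delta> \<in> invariant_differences (G\<lparr>carrier := C\<rparr>)"
    "\<And>t. norm (k t) \<le> 1" "\<Delta> (linf_functional (G\<lparr>carrier := C\<rparr>) k) = 1"
    by (rule nonzero_invariant_difference[OF BC(4,6) M]) blast+
  have "\<Gamma> \<in> ell1_bidual (G\<lparr>carrier := B\<rparr>)" "\<Delta> \<in> ell1_bidual (G\<lparr>carrier := C\<rparr>)"
    using G(1) D(1) by (simp_all add: invariant_differences_def)
  then have "arens G (bidual_inclusion G B \<Gamma>) (bidual_inclusion G C \<Delta>) \<noteq> 0"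
    using arens_product_nonzero[OF BC(3,4,7), of \<Gamma> \<Delta> f k] G(2,3) D(2,3) by blast
  moreover have "bidual_inclusion G B \<Gamma> \<in> D_sn G" "bidual_inclusion G C \<Delta> \<in> D_sn G"
    using BC(1,2) G(1) D(1) by (auto simp: D_sn_def)
  then have "bidual_inclusion G B \<Gamma> \<in> A_sn G" "bidual_inclusion G C \<Delta> \<in> A_sn G"
    using D_sn_subset_A_sn by blast+
  ultimately show False using zero by (simp add: square_zero_def)
qed

end

theorem theorem4p1:
  fixes G :: "('a, 'b) monoid_scheme"
  assumes "group G" and "amenable G" and "just_infinite G"
  shows "(hereditarily_just_infinite G \<longleftrightarrow> square_zero G (J_sn G)) \<and>
         (square_zero G (J_sn G) \<longleftrightarrow> square_zero G (A_sn G))"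
proof -
  interpret group G by (rule assms(1))
  have "hereditarily_just_infinite G \<Longrightarrow> square_zero G (J_sn G)"
    using J_sn_square_zero hereditarily_just_infinite_subnormal by blast
  moreover have "square_zero G (J_sn G) \<Longrightarrow> square_zero G (A_sn G)"
    using A_sn_subset_J_sn unfolding square_zero_def by blast
  moreover have "square_zero G (A_sn G) \<Longrightarrow> hereditarily_just_infinite G"
    by (rule hereditarily_just_infinite_if_A_sn_square_zero[OF assms(2,3)])
  ultimately show ?thesis by blast
qed

end
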